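(* Let $\lambda\in\mathbb{R}$. For every $s\ge 0$ and every $\gamma>2$, there exists a real-valued $\xi\in H^s(\mathbb{T})$ such that the Cauchy problem $$i\partial_t u+\partial_{xx}u+\xi u=\lambda|u|^2u\quad (x\in\mathbb{T},\ t>0),\qquad u(0,x)=u_0(x),$$ is ill-posed in $H^{s+\gamma}(\mathbb{T})$.
   Context: $\mathbb{T}=(-\pi,\pi)$ is the one-dimensional torus (periodic boundary conditions); $u(t,x)$ is complex-valued. $H^\sigma(\mathbb{T})$ is the usual $L^2$-based Sobolev space. Solutions are understood through Duhamel's formula $u(t)=e^{it\partial_x^2}u_0+i\int_0^te^{i(t-\rho)\partial_x^2}\big(\xi u(\rho)-\lambda|u(\rho)|^2u(\rho)\big)\,d\rho$, and $u[u_0]$ denotes the solution with data $u_0$. Ill-posedness in $X_0$: for $\epsilon>0$ let $B(\epsilon)=\{u_0\in\mathcal{S}:\ \|u_0\|_{X_0}\le\epsilon\}$, where $\mathcal S$ is the Schwartz space (on $\mathbb{T}$: smooth periodic functions). The problem is ill-posed in $X_0$ if for arbitrarily small $\epsilon>0$ there exists $u_0\in B(\epsilon)$ such that the solution map $u_0\mapsto u[u_0]$ is discontinuous from $X_0$ to $C([0,1];X_0)$. *)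

theory Defs
  imports "HOL-Analysis.Analysis"
begin

text \<open>
  Functions on the torus are represented by functions on the reals of which only the values on the
  period cell \<open>(-\<pi>, \<pi>)\<close>, up to null sets, matter.
\<close>

abbreviation torus :: "real measure" where
  "torus \<equiv> lebesgue_on {-pi<..<pi}"

definition fourier_coeff :: "(real \<Rightarrow> complex) \<Rightarrow> int \<Rightarrow> complex" where
  "fourier_coeff f k = (1 / (2 * pi)) * (LINT x|torus. f x * cis (- of_int k * x))"

definition torus_L2 :: "(real \<Rightarrow> complex) set" where
  "torus_L2 = {f \<in> borel_measurable torus. integrable torus (\<lambda>x. (norm (f x))\<^sup>2)}"

text \<open>
  The Sobolev space \<open>H\<^sup>\<sigma>\<close> is only used for \<open>\<sigma> \<ge> 0\<close>, where its elements are square-integrable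
  functions. The norm is meaningful on the space only (a divergent \<open>infsum\<close> is \<open>0\<close>).
\<close>

definition sobolev :: "real \<Rightarrow> (real \<Rightarrow> complex) set" where
  "sobolev \<sigma> = {f \<in> torus_L2.
     (\<lambda>k::int. (1 + (of_int k)\<^sup>2) powr \<sigma> * (norm (fourier_coeff f k))\<^sup>2) summable_on UNIV}"

definition sobolev_norm :: "real \<Rightarrow> (real \<Rightarrow> complex) \<Rightarrow> real" where
  "sobolev_norm \<sigma> f =
     sqrt (\<Sum>\<^sub>\<infinity>k::int. (1 + (of_int k)\<^sup>2) powr \<sigma> * (norm (fourier_coeff f k))\<^sup>2)"

definition sobolev_dist :: "real \<Rightarrow> (real \<Rightarrow> complex) \<Rightarrow> (real \<Rightarrow> complex) \<Rightarrow> real" where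
  "sobolev_dist \<sigma> f g = sobolev_norm \<sigma> (\<lambda>x. f x - g x)"

text \<open>The space \<open>C([0,1]; H\<^sup>\<sigma>)\<close>.\<close>

definition C01_sobolev :: "real \<Rightarrow> (real \<Rightarrow> real \<Rightarrow> complex) set" where
  "C01_sobolev \<sigma> = {u. (\<forall>t\<in>{0..1}. u t \<in> sobolev \<sigma>) \<and>
     (\<forall>t\<in>{0..1}. ((\<lambda>r. sobolev_dist \<sigma> (u r) (u t)) \<longlongrightarrow> 0) (at t within {0..1}))}"

definition smooth_periodic :: "(real \<Rightarrow> complex) set" where
  "smooth_periodic = {f. (\<forall>x. f (x + 2 * pi) = f x) \<and>
     (\<exists>D :: nat \<Rightarrow> real \<Rightarrow> complex. D 0 = f \<and>
        (\<forall>n x. (D n has_vector_derivative D (Suc n) x) (at x)))}"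

text \<open>
  The group \<open>exp (i t \<partial>\<^sub>x\<^sub>x)\<close> acts on Fourier coefficients as the multiplier \<open>exp (- i t k\<^sup>2)\<close>.
\<close>

definition schroedinger_group :: "real \<Rightarrow> (int \<Rightarrow> complex) \<Rightarrow> int \<Rightarrow> complex" where
  "schroedinger_group t c k = cis (- t * (of_int k)\<^sup>2) * c k"

definition forcing :: "(real \<Rightarrow> real) \<Rightarrow> real \<Rightarrow> (real \<Rightarrow> complex) \<Rightarrow> real \<Rightarrow> complex" where
  "forcing \<xi> lam v x = of_real (\<xi> x) * v x - of_real lam * (of_real (norm (v x)))\<^sup>2 * v x"

text \<open>
  Duhamel's formula on \<open>[0,1]\<close>, as an identity between Fourier coefficients. The integrability
  requirements ensure that all integrals occurring in it are genuine; they hold automatically for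
  \<open>\<xi> \<in> L\<^sup>2\<close> and \<open>u \<in> C([0,1]; H\<^sup>\<sigma>)\<close> with \<open>\<sigma> > 1/2\<close>.
\<close>

definition duhamel_solution ::
    "(real \<Rightarrow> real) \<Rightarrow> real \<Rightarrow> (real \<Rightarrow> complex) \<Rightarrow> (real \<Rightarrow> real \<Rightarrow> complex) \<Rightarrow> bool" where
  "duhamel_solution \<xi> lam u0 u \<longleftrightarrow>
     (\<forall>t\<in>{0..1}. u t \<in> torus_L2 \<and> integrable torus (forcing \<xi> lam (u t))) \<and>
     (\<forall>t\<in>{0..1}. \<forall>k.
        set_integrable lebesgue {0..t}
          (\<lambda>\<rho>. schroedinger_group (t - \<rho>) (fourier_coeff (forcing \<xi> lam (u \<rho>))) k) \<and>
        fourier_coeff (u t) k =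
          schroedinger_group t (fourier_coeff u0) k +
          \<i> * (LINT \<rho>:{0..t}|lebesgue.
                 schroedinger_group (t - \<rho>) (fourier_coeff (forcing \<xi> lam (u \<rho>))) k))"

text \<open>
  Continuity at \<open>u0\<close> of the solution map from \<open>H\<^sup>\<sigma>\<close> to \<open>C([0,1]; H\<^sup>\<sigma>)\<close>. In particular the map has to be
  defined near \<open>u0\<close> with values in \<open>C([0,1]; H\<^sup>\<sigma>)\<close>: if the solution emanating from \<open>u0\<close> leaves
  \<open>H\<^sup>\<sigma>\<close>, the solution map is not continuous there.
\<close>

definition solution_map_continuous_at ::
    "(real \<Rightarrow> real) \<Rightarrow> real \<Rightarrow> real \<Rightarrow> (real \<Rightarrow> complex) \<Rightarrow> bool" where
  "solution_map_continuous_at \<xi> lam \<sigma> u0 \<longleftrightarrow>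
     (\<exists>\<Phi> :: (real \<Rightarrow> complex) \<Rightarrow> real \<Rightarrow> real \<Rightarrow> complex.
        (\<exists>r>0. \<forall>v0\<in>sobolev \<sigma>. sobolev_dist \<sigma> v0 u0 < r \<longrightarrow>
           duhamel_solution \<xi> lam v0 (\<Phi> v0) \<and> \<Phi> v0 \<in> C01_sobolev \<sigma>) \<and>
        (\<forall>\<eta>>0. \<exists>\<delta>>0. \<forall>v0\<in>sobolev \<sigma>. sobolev_dist \<sigma> v0 u0 < \<delta> \<longrightarrow>
           (\<forall>t\<in>{0..1}. sobolev_dist \<sigma> (\<Phi> v0 t) (\<Phi> u0 t) < \<eta>)))"

definition smooth_ball :: "real \<Rightarrow> real \<Rightarrow> (real \<Rightarrow> complex) set" where
  "smooth_ball \<sigma> \<epsilon> = {u0 \<in> smooth_periodic. sobolev_norm \<sigma> u0 \<le> \<epsilon>}"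

definition ill_posed :: "(real \<Rightarrow> real) \<Rightarrow> real \<Rightarrow> real \<Rightarrow> bool" where
  "ill_posed \<xi> lam \<sigma> \<longleftrightarrow>
     (\<forall>\<epsilon>>0. \<exists>u0\<in>smooth_ball \<sigma> \<epsilon>. \<not> solution_map_continuous_at \<xi> lam \<sigma> u0)"

end

theory Submission
  imports Defs
begin

text \<open>
  The obstruction is that \<open>\<xi> u\<close> is only as smooth as \<open>\<xi>\<close>, while the Schroedinger evolution gains at
  most two derivatives in time-integrated form. So if \<open>\<xi>\<close> lies in \<open>H\<^sup>s\<close> but not in \<open>H\<close> of order
  \<open>s + \<gamma> - 2 > s\<close>, a solution with values in \<open>H\<close> of order \<open>\<sigma> = s + \<gamma>\<close> cannot exist even
  for constant data \<open>\<epsilon>\<close>, and the solution map is not defined there, let alone continuous.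

  A lacunary potential makes this visible on single Fourier modes. Let
  \<open>\<xi> x = (\<Sum>j. 2 powr (- \<alpha> * j) * cos (2 ^ j * x))\<close> with \<open>s < \<alpha> < s + \<gamma> - 2\<close>; then \<open>\<xi>\<close> is in \<open>H\<^sup>s\<close>
  (lemma \<open>lacunary_in_sobolev\<close>). Suppose that \<open>u\<close> in \<open>C([0,1]; H\<^sup>\<sigma>)\<close> solves Duhamel's formula with
  data \<open>\<epsilon>\<close>. By continuity at time \<open>0\<close> there is a short time interval on which the mean of \<open>u t\<close>
  is within \<open>\<epsilon> / 4\<close> of \<open>\<epsilon>\<close> and the \<open>k\<close>-th coefficient is of size \<open>O(\<bar>k\<bar> powr - \<sigma>)\<close>, uniformly in \<open>t\<close>.
  At the frequency \<open>N = 2 ^ J\<close> the product \<open>\<xi> u\<close> has the resonant term \<open>N powr - \<alpha> / 2\<close> times the mean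
  of \<open>u\<close>; in all other terms \<open>u\<close> is evaluated at a frequency of size at least \<open>N / 2\<close>, because the
  frequencies of \<open>\<xi>\<close> are far apart, so these terms are \<open>O(N powr - \<sigma>)\<close>
  (lemma \<open>fourier_coeff_lacunary_mult_resonance\<close>). The cubic term is \<open>O(N powr - \<sigma>)\<close> too, since
  sequences of this decay are stable under convolution (lemma \<open>fourier_decay_cubic\<close>).

  Now look at Duhamel's formula at time \<open>t = 1 / N\<^sup>2\<close>. Up to this time the phase
  \<open>exp (- i (t - \<rho>) N\<^sup>2)\<close> turns by at most one radian, so the resonant term does not cancel and
  contributes at least a constant times \<open>t * N powr - \<alpha> = N powr (- \<alpha> - 2)\<close> to the \<open>N\<close>-th
  coefficient of \<open>u t\<close>. But this coefficient is \<open>O(N powr - \<sigma>)\<close>, and \<open>\<sigma> > \<alpha> + 2\<close>: a contradiction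
  for large \<open>N\<close> (lemma \<open>no_solution_in_C01_sobolev\<close>).

  The only fact from Fourier analysis that needs an argument is that an integrable function with absolutely summable Fourier
  coefficients is almost everywhere the sum of its Fourier series, which follows from uniqueness of
  Fourier coefficients and hence from the Stone-Weierstrass theorem.
\<close>

section \<open>Fourier coefficients on the torus\<close>

lemma borel_imp_torus_measurable:
  "h \<in> borel_measurable borel \<Longrightarrow> h \<in> borel_measurable torus"
  by (simp add: measurable_completion measurable_restrict_space1)

lemma cis_linear_measurable [measurable]: "(\<lambda>x. cis (a * x)) \<in> borel_measurable torus"
  by (intro borel_imp_torus_measurable borel_measurable_continuous_onI continuous_intros)

lemma finite_measure_torus: "finite_measure torus"
  by (rule finite_measure_lebesgue_on) (simp add: bounded_set_imp_lmeasurable)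

lemma integrable_torus_const: "integrable torus (\<lambda>x. c :: complex)"
  using finite_measure_torus by (simp add: finite_measure.integrable_const)

lemma integrable_bounded_mult:
  fixes f h :: "real \<Rightarrow> complex"
  assumes f: "integrable torus f" and h: "h \<in> borel_measurable torus" and B: "\<And>x. norm (h x) \<le> B"
  shows "integrable torus (\<lambda>x. h x * f x)"
proof (rule Bochner_Integration.integrable_bound)
  show "integrable torus (\<lambda>x. B * norm (f x))"
    using f by simp
  show "(\<lambda>x. h x * f x) \<in> borel_measurable torus"
    using f h by auto
  have "norm (h x * f x) \<le> norm (B * norm (f x))" for x
    using mult_right_mono[OF order_trans[OF B abs_ge_self], of "norm (f x)" x] by (simp add: norm_mult abs_mult)
  then show "AE x in torus. norm (h x * f x) \<le> norm (B * norm (f x))"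
    by simp
qed

lemma integrable_cis_mult:
  assumes "integrable torus f"
  shows "integrable torus (\<lambda>x. cis (a * x) * f x)"
  by (rule integrable_bounded_mult[OF assms, where B=1]) auto

lemma integrable_mult_cis:
  assumes "integrable torus f"
  shows "integrable torus (\<lambda>x. f x * cis (a * x))"
  using integrable_cis_mult[OF assms, of a] by (simp only: mult.commute[of "f _"])

lemma fourier_coeff_add:
  assumes "integrable torus f" "integrable torus g"
  shows "fourier_coeff (\<lambda>x. f x + g x) k = fourier_coeff f k + fourier_coeff g k"
  using integrable_mult_cis[OF assms(1), of "- of_int k"] integrable_mult_cis[OF assms(2), of "- of_int k"]
  by (simp add: fourier_coeff_def distrib_right add_divide_distrib)

lemma fourier_coeff_diff:
  assumes "integrable torus f" "integrable torus g"
  shows "fourier_coeff (\<lambda>x. f x - g x) k = fourier_coeff f k - fourier_coeff g k"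
  using integrable_mult_cis[OF assms(1), of "- of_int k"] integrable_mult_cis[OF assms(2), of "- of_int k"]
  by (simp add: fourier_coeff_def left_diff_distrib diff_divide_distrib)

lemma fourier_coeff_cmult:
  "fourier_coeff (\<lambda>x. c * f x) k = c * fourier_coeff f k"
  by (simp add: fourier_coeff_def mult.assoc)

lemma fourier_coeff_cnj:
  "fourier_coeff (\<lambda>x. cnj (f x)) k = cnj (fourier_coeff f (- k))"
proof -
  have "cnj (f x) * cis (- of_int k * x) = cnj (f x * cis (- of_int (- k) * x))" for x
    by (simp add: cis_cnj)
  then show ?thesis
    unfolding fourier_coeff_def by (simp only: Bochner_Integration.integral_cnj) simp
qed

lemma fourier_coeff_modulate:
  "fourier_coeff (\<lambda>x. cis (of_int m * x) * f x) k = fourier_coeff f (k - m)"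
proof -
  have "cis (of_int m * x) * f x * cis (- of_int k * x) = f x * cis (- of_int (k - m) * x)" for x
  proof -
    have "cis (- of_int (k - m) * x) = cis (of_int m * x) * cis (- of_int k * x)"
      unfolding cis_mult by (simp add: algebra_simps)
    then show ?thesis
      by (simp only: ac_simps)
  qed
  then show ?thesis
    unfolding fourier_coeff_def by (simp only:)
qed

lemma fourier_coeff_const:
  "fourier_coeff (\<lambda>x. c) k = (if k = 0 then c else 0)"
proof (cases "k = 0")
  case True
  have "measure torus (space torus) = 2 * pi"
    by (simp add: measure_restrict_space)
  then show ?thesis
    using True by (simp add: fourier_coeff_def scaleR_conv_of_real)
next
  case False
  let ?F = "\<lambda>x. cis (- of_int k * x) / (- \<i> * of_int k)"
  have int: "integrable torus (\<lambda>x. cis (- of_int k * x))"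
    using integrable_mult_cis[OF integrable_torus_const[of 1], of "- of_int k"] by simp
  have deriv: "(?F has_vector_derivative cis (- of_int k * x)) (at x within {-pi..pi})" for x
  proof -
    have "((\<lambda>x. cis (- of_int k * x)) has_derivative (\<lambda>t. (- of_int k * t) *\<^sub>R (\<i> * cis (- of_int k * x)))) (at x within {-pi..pi})"
      by (rule has_derivative_cis) (auto intro!: derivative_eq_intros)
    then have "((\<lambda>x. cis (- of_int k * x)) has_vector_derivative (- \<i> * of_int k) * cis (- of_int k * x)) (at x within {-pi..pi})"
      by (simp add: has_vector_derivative_def scaleR_conv_of_real mult_ac)
    from has_vector_derivative_divide[OF this, of "- \<i> * of_int k"] False show ?thesis
      by simp
  qed
  have "((\<lambda>x. cis (- of_int k * x)) has_integral (?F pi - ?F (-pi))) {-pi..pi}"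
    by (rule fundamental_theorem_of_calculus) (use deriv in auto)
  moreover have "cis (of_int k * pi) = cis (- (of_int k * pi))"
    using sin_npi_int[of k] by (simp add: complex_eq_iff mult.commute)
  ultimately have "((\<lambda>x. cis (- of_int k * x)) has_integral 0) {-pi..pi}"
    by simp
  then have "((\<lambda>x. cis (- of_int k * x)) has_integral 0) {-pi<..<pi}"
    using has_integral_open_interval[of "\<lambda>x. cis (- of_int k * x)" 0 "-pi" pi] by simp
  moreover have "((\<lambda>x. cis (- of_int k * x)) has_integral (LINT x|torus. cis (- of_int k * x))) {-pi<..<pi}"
    by (rule has_integral_integral_lebesgue_on[OF int]) simp
  ultimately have "(LINT x|torus. cis (- of_int k * x)) = 0"
    by (rule has_integral_unique[symmetric])
  then show ?thesis
    using False by (simp add: fourier_coeff_def)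
qed

text \<open>
  The product with an absolutely convergent exponential series is integrated term by term. Only the
  factor \<open>g\<close> has to be given by its series; \<open>f\<close> is an arbitrary integrable function, so no Fourier
  expansion of \<open>f\<close> enters. The frequencies \<open>m n\<close> are enumerated by naturals in order to use the
  exchange of integrals with series; \<open>m\<close> may enumerate all integers or a sparse set of them.
\<close>

lemma fourier_coeff_mult_series:
  fixes b :: "nat \<Rightarrow> complex" and m :: "nat \<Rightarrow> int"
  assumes f: "integrable torus f" and b: "summable (\<lambda>n. norm (b n))"
    and g: "AE x in torus. g x = (\<Sum>n. b n * cis (of_int (m n) * x))"
    and gm: "g \<in> borel_measurable torus"
  shows "integrable torus (\<lambda>x. g x * f x)"
    and "(\<lambda>n. b n * fourier_coeff f (k - m n)) sums fourier_coeff (\<lambda>x. g x * f x) k"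
proof -
  have int: "integrable torus (\<lambda>x. b n * (cis (of_int (m n) * x) * f x))" for n
    using integrable_cis_mult[OF f] by simp
  have sn: "summable (\<lambda>n. norm (b n * (cis (of_int (m n) * x) * f x)))" for x
    using summable_mult2[OF b, of "norm (f x)"] by (simp add: norm_mult mult.assoc)
  have si: "summable (\<lambda>n. LINT x|torus. norm (b n * (cis (of_int (m n) * x) * f x)))"
    using summable_mult2[OF b, of "LINT x|torus. norm (f x)"] by (simp add: norm_mult)
  have eq: "(\<Sum>n. b n * (cis (of_int (m n) * x) * f x)) = (\<Sum>n. b n * cis (of_int (m n) * x)) * f x" for x
  proof -
    have "summable (\<lambda>n. b n * cis (of_int (m n) * x))"
      by (rule summable_norm_cancel) (use b in \<open>simp add: norm_mult\<close>)
    from suminf_mult2[OF this, of "f x"] show ?thesis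
      by (simp add: mult.assoc)
  qed
  have AEeq: "AE x in torus. (\<Sum>n. b n * (cis (of_int (m n) * x) * f x)) = g x * f x"
    using g by eventually_elim (simp add: eq)
  have "integrable torus (\<lambda>x. \<Sum>n. b n * (cis (of_int (m n) * x) * f x))"
    by (rule integrable_suminf[OF int _ si]) (use sn in auto)
  then show gf: "integrable torus (\<lambda>x. g x * f x)"
    by (rule integrable_cong_AE_imp) (use f gm AEeq in auto)
  let ?h = "\<lambda>n x. b n * (cis (of_int (m n) * x) * f x) * cis (- of_int k * x)"
  have "(\<lambda>n. integral\<^sup>L torus (?h n)) sums (LINT x|torus. (\<Sum>n. ?h n x))"
  proof (rule sums_integral)
    show "integrable torus (?h n)" for n
      by (rule integrable_mult_cis[OF int])
    show "AE x in torus. summable (\<lambda>n. norm (?h n x))"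
      using sn by (simp add: norm_mult)
    show "summable (\<lambda>n. LINT x|torus. norm (?h n x))"
      using si by (simp add: norm_mult)
  qed
  moreover have "(LINT x|torus. (\<Sum>n. ?h n x)) = (LINT x|torus. g x * f x * cis (- of_int k * x))"
  proof (rule integral_cong_AE)
    show "(\<lambda>x. \<Sum>n. ?h n x) \<in> borel_measurable torus"
      using int integrable_mult_cis by (intro borel_measurable_suminf borel_measurable_integrable) blast
    show "(\<lambda>x. g x * f x * cis (- of_int k * x)) \<in> borel_measurable torus"
      by (rule borel_measurable_integrable[OF integrable_mult_cis[OF gf]])
    show "AE x in torus. (\<Sum>n. ?h n x) = g x * f x * cis (- of_int k * x)"
      using AEeq
    proof eventually_elim
      case (elim x)
      have "summable (\<lambda>n. b n * (cis (of_int (m n) * x) * f x))"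
        by (rule summable_norm_cancel[OF sn])
      from suminf_mult2[OF this, of "cis (- of_int k * x)"] elim show ?case
        by simp
    qed
  qed
  ultimately have "(\<lambda>n. (1 / (2 * pi)) * integral\<^sup>L torus (?h n)) sums fourier_coeff (\<lambda>x. g x * f x) k"
    unfolding fourier_coeff_def by (intro sums_mult) simp
  moreover have "(1 / (2 * pi)) * integral\<^sup>L torus (?h n) = b n * fourier_coeff f (k - m n)" for n
  proof -
    have "(1 / (2 * pi)) * integral\<^sup>L torus (?h n) = fourier_coeff (\<lambda>x. b n * (cis (of_int (m n) * x) * f x)) k"
      by (simp add: fourier_coeff_def)
    then show ?thesis
      by (simp add: fourier_coeff_cmult fourier_coeff_modulate)
  qed
  ultimately show "(\<lambda>n. b n * fourier_coeff f (k - m n)) sums fourier_coeff (\<lambda>x. g x * f x) k"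
    by simp
qed

section \<open>Uniqueness of Fourier coefficients\<close>

lemma bounded_linear_on_circle:
  fixes g :: "complex \<Rightarrow> real"
  assumes "bounded_linear g"
  shows "complex_of_real (g (cis x)) =
    of_real (g 1) / 2 * (cis x + cis (- x)) + of_real (g \<i>) / (2 * \<i>) * (cis x - cis (- x))"
proof -
  interpret bounded_linear g by fact
  have "cis x = cos x *\<^sub>R 1 + sin x *\<^sub>R \<i>"
    by (simp add: complex_eq_iff)
  then have "g (cis x) = cos x * g 1 + sin x * g \<i>"
    by (simp only: add scaleR) simp
  then show ?thesis
    by (simp add: complex_eq_iff Re_divide Im_divide field_simps)
qed

text \<open>
  The functions with vanishing Fourier coefficients are stable under multiplication by
  \<open>cis x\<close> and \<open>cis (- x)\<close>, as this only shifts the coefficients. A linear function on the circle is a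
  combination of these two exponentials, so stability passes on to all polynomials; the product case
  of the induction applies the hypotheses one after the other, which is why \<open>f\<close> has to be arbitrary.
\<close>

lemma fourier_vanish_times_polynomial:
  fixes g :: "complex \<Rightarrow> real"
  assumes "real_polynomial_function g"
    and "integrable torus f" and "\<And>k. fourier_coeff f k = 0"
  shows "integrable torus (\<lambda>x. of_real (g (cis x)) * f x) \<and>
    (\<forall>k. fourier_coeff (\<lambda>x. of_real (g (cis x)) * f x) k = 0)"
  using assms
proof (induction arbitrary: f rule: real_polynomial_function.induct)
  case (linear g)
  have int: "integrable torus (\<lambda>x. cis x * f x)" "integrable torus (\<lambda>x. cis (- x) * f x)"
    using integrable_cis_mult[OF linear(2), of 1] integrable_cis_mult[OF linear(2), of "-1"] by simp_all
  have zero: "fourier_coeff (\<lambda>x. cis x * f x) k = 0" "fourier_coeff (\<lambda>x. cis (- x) * f x) k = 0" for k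
    using fourier_coeff_modulate[of 1 f k] fourier_coeff_modulate[of "-1" f k] linear(3) by simp_all
  obtain \<alpha> \<beta> where g: "\<And>x. complex_of_real (g (cis x)) = \<alpha> * (cis x + cis (- x)) + \<beta> * (cis x - cis (- x))"
    using bounded_linear_on_circle[OF linear(1)] by blast
  have eq: "(\<lambda>x. of_real (g (cis x)) * f x) =
      (\<lambda>x. \<alpha> * (cis x * f x + cis (- x) * f x) + \<beta> * (cis x * f x - cis (- x) * f x))"
    by (simp only: g algebra_simps)
  show ?case
    unfolding eq using int zero
    by (simp add: fourier_coeff_add fourier_coeff_cmult fourier_coeff_diff)
next
  case (const c)
  then show ?case
    by (simp add: fourier_coeff_cmult)
next
  case (add g h)
  from add.IH(1)[OF add.prems] add.IH(2)[OF add.prems] show ?case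
    by (simp add: distrib_right fourier_coeff_add)
next
  case (mult g h)
  note h = mult.IH(2)[OF mult.prems]
  from mult.IH(1)[of "\<lambda>x. of_real (h (cis x)) * f x"] h show ?case
    by (simp add: mult.assoc)
qed

lemma LINT_eq_fourier_coeff: "(LINT x|torus. f x) = 2 * pi * fourier_coeff f 0"
  by (simp add: fourier_coeff_def)

text \<open>
  Continuous functions on the circle are uniform limits of polynomials in the real and imaginary
  part, for which the integral vanishes.
\<close>

lemma fourier_vanish_integral_continuous:
  fixes h :: "complex \<Rightarrow> real"
  assumes f: "integrable torus f" "\<And>k. fourier_coeff f k = 0" and h: "continuous_on UNIV h"
  shows "(LINT x|torus. of_real (h (cis x)) * f x) = 0"
proof -
  let ?I = "LINT x|torus. of_real (h (cis x)) * f x"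
  let ?L = "LINT x|torus. norm (f x)"
  have "norm ?I \<le> e * ?L" if e: "e > 0" for e
  proof -
    obtain p where p: "real_polynomial_function p" and approx: "\<And>z. z \<in> sphere 0 1 \<Longrightarrow> \<bar>h z - p z\<bar> < e"
      using Stone_Weierstrass_real_polynomial_function[of "sphere 0 1" h e] h e
      by (metis compact_sphere continuous_on_subset subset_UNIV)
    have le: "\<bar>h (cis x) - p (cis x)\<bar> \<le> e" for x
      using approx[of "cis x"] by simp
    have cont: "continuous_on UNIV (\<lambda>x. p (cis x))" "continuous_on UNIV (\<lambda>x. h (cis x))"
      using continuous_on_polymonial_function[of p UNIV] p
        continuous_on_compose2[OF h continuous_on_cis[OF continuous_on_id]]
        continuous_on_compose2[of UNIV p UNIV cis, OF _ continuous_on_cis[OF continuous_on_id]]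
      by (auto simp: real_polynomial_function_eq)
    have pI: "integrable torus (\<lambda>x. of_real (p (cis x)) * f x)" "(LINT x|torus. of_real (p (cis x)) * f x) = 0"
      using fourier_vanish_times_polynomial[OF p f] LINT_eq_fourier_coeff by auto
    have dI: "integrable torus (\<lambda>x. of_real (h (cis x) - p (cis x)) * f x)"
      using le cont by (intro integrable_bounded_mult[OF f(1), where B=e] borel_imp_torus_measurable
          borel_measurable_continuous_onI continuous_intros) (auto simp flip: of_real_diff)
    have "(\<lambda>x. of_real (h (cis x)) * f x) = (\<lambda>x. of_real (h (cis x) - p (cis x)) * f x + of_real (p (cis x)) * f x)"
      by (simp add: fun_eq_iff algebra_simps)
    then have "?I = (LINT x|torus. of_real (h (cis x) - p (cis x)) * f x)"
      using Bochner_Integration.integral_add[OF dI pI(1)] pI(2) by simp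
    also have "norm \<dots> \<le> (LINT x|torus. e * norm (f x))"
    proof (rule order_trans[OF integral_norm_bound integral_mono])
      show "integrable torus (\<lambda>x. norm (of_real (h (cis x) - p (cis x)) * f x))"
        using dI by (rule integrable_norm)
      show "norm (of_real (h (cis x) - p (cis x)) * f x) \<le> e * norm (f x)" for x
        unfolding norm_mult norm_of_real using le[of x] by (rule mult_right_mono) simp
    qed (use f in simp)
    finally show ?thesis
      by simp
  qed
  moreover have "((\<lambda>e. e * ?L) \<longlongrightarrow> 0 * ?L) (at_right 0)"
    by (intro tendsto_intros)
  ultimately have "norm ?I \<le> 0"
    by (intro tendsto_lowerbound[of "\<lambda>e. e * ?L" _ "at_right 0"]) (auto simp: eventually_at_right_less intro: eventually_mono[OF eventually_at_right_less])
  then show ?thesis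
    by simp
qed

lemma inj_on_cis: "inj_on cis {-pi<..<pi}"
proof (rule inj_on_inverseI)
  show "Arg (cis x) = x" if "x \<in> {-pi<..<pi}" for x
    using that by (intro Arg_cis) auto
qed

text \<open>
  The indicator of a compact set is the pointwise limit of the continuous tents
  \<open>max 0 (1 - n * d)\<close>, where \<open>d\<close> is the distance on the circle to the image of the set. This image
  determines the set because \<open>cis\<close> is injective on the open period cell.
\<close>

lemma fourier_vanish_integral_compact:
  assumes f: "integrable torus f" "\<And>k. fourier_coeff f k = 0"
    and K: "compact K" "K \<subseteq> {-pi<..<pi}"
  shows "(LINT x|torus. indicator K x *\<^sub>R f x) = 0"
proof (cases "K = {}")
  case False
  define d where "d z = infdist z (cis ` K)" for z
  define h where "h n z = max 0 (1 - real n * d z)" for n z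
  have compact: "compact (cis ` K)"
    using K by (intro compact_continuous_image continuous_intros)
  have d0: "d (cis x) = 0 \<longleftrightarrow> x \<in> K" if "x \<in> {-pi<..<pi}" for x
  proof -
    have "d (cis x) = 0 \<longleftrightarrow> cis x \<in> cis ` K"
      unfolding d_def using compact False by (subst in_closed_iff_infdist_zero) (auto simp: compact_imp_closed)
    then show ?thesis
      using inj_on_image_mem_iff[OF inj_on_cis that K(2)] by simp
  qed
  have dnn: "d z \<ge> 0" for z
    by (simp add: d_def infdist_nonneg)
  have cont: "continuous_on UNIV (h n)" for n
    unfolding h_def d_def by (intro continuous_intros)
  have "(\<lambda>n. LINT x|torus. of_real (h n (cis x)) * f x) \<longlonglongrightarrow> (LINT x|torus. indicator K x *\<^sub>R f x)"
  proof (rule integral_dominated_convergence[where w="\<lambda>x. norm (f x)"])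
    show "(\<lambda>x. indicator K x *\<^sub>R f x) \<in> borel_measurable torus"
      using f K by (intro borel_measurable_scaleR borel_measurable_indicator) 
        (auto simp: sets_restrict_space_iff compact_imp_closed)
    show "(\<lambda>x. of_real (h n (cis x)) * f x) \<in> borel_measurable torus" for n
    proof -
      have "continuous_on UNIV (\<lambda>x. complex_of_real (h n (cis x)))"
        by (intro continuous_on_of_real continuous_on_compose2[OF cont continuous_on_cis[OF continuous_on_id]]) auto
      from borel_imp_torus_measurable[OF borel_measurable_continuous_onI[OF this]] f show ?thesis
        by auto
    qed
    show "integrable torus (\<lambda>x. norm (f x))"
      using f by simp
    have "(\<lambda>n. of_real (h n (cis x)) * f x) \<longlonglongrightarrow> indicator K x *\<^sub>R f x" if x: "x \<in> {-pi<..<pi}" for x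
    proof (cases "x \<in> K")
      case True
      then show ?thesis
        using d0[OF x] by (simp add: h_def)
    next
      case False
      then have pos: "d (cis x) > 0"
        using d0[OF x] dnn[of "cis x"] by linarith
      have "eventually (\<lambda>n. h n (cis x) = 0) sequentially"
      proof -
        obtain n0 where "1 / d (cis x) < real n0"
          using reals_Archimedean2 by blast
        then have "h n (cis x) = 0" if "n \<ge> n0" for n
          using pos that order_less_le_trans[of "1 / d (cis x)" "real n0" "real n"]
          by (simp add: h_def field_simps)
        then show ?thesis
          by (auto simp: eventually_sequentially)
      qed
      then have "eventually (\<lambda>n. of_real (h n (cis x)) * f x = indicator K x *\<^sub>R f x) sequentially"
        by eventually_elim (use False in simp)
      then show ?thesis
        by (rule tendsto_eventually)
    qed
    then show "AE x in torus. (\<lambda>n. of_real (h n (cis x)) * f x) \<longlonglongrightarrow> indicator K x *\<^sub>R f x"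
      by (auto intro: AE_I2)
    have "\<bar>h n z\<bar> \<le> 1" for n z
      using dnn[of z] by (simp add: h_def)
    then show "AE x in torus. norm (of_real (h n (cis x)) * f x) \<le> norm (f x)" for n
      by (simp add: norm_mult mult_left_le_one_le)
  qed
  then have "(\<lambda>n. 0) \<longlonglongrightarrow> (LINT x|torus. indicator K x *\<^sub>R f x)"
    using fourier_vanish_integral_continuous[OF f cont] by simp
  then show ?thesis
    by (rule LIMSEQ_unique) (rule tendsto_const)
qed simp

text \<open>
  A measurable set is, up to a null set, an increasing union of compact sets, so the integral of \<open>f\<close>
  vanishes over every measurable set.
\<close>

lemma fourier_vanish_imp_AE_zero:
  assumes f: "integrable torus f" "\<And>k. fourier_coeff f k = 0"
  shows "AE x in torus. f x = 0"
proof -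
  interpret finite_measure torus by (rule finite_measure_torus)
  show ?thesis
  proof (rule density_zero[OF f(1)])
    fix A assume A: "A \<in> sets torus"
    then have sub: "A \<subseteq> {-pi<..<pi}" and AL: "A \<in> sets lebesgue"
      by (auto simp: sets_restrict_space_iff)
    from lebesgue_set_almost_fsigma[OF AL] obtain C T where C: "fsigma C" and T: "T \<in> null_sets lebesgue"
      and CT: "C \<union> T = A" "disjnt C T" by blast
    from C obtain F :: "nat \<Rightarrow> real set" where F: "\<And>n. closed (F n)" "C = (\<Union>n. F n)"
      by (auto simp: fsigma.simps)
    define K where "K n = (\<Union>i<n. F i)" for n
    have KC: "(\<Union>n. K n) = C"
      by (auto simp: K_def F)
    have Ksub: "K n \<subseteq> {-pi<..<pi}" for n
      using KC CT sub by blast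
    have Kc: "compact (K n)" for n
    proof -
      have "K n \<subseteq> {-pi..pi}"
        using Ksub[of n] by force
      moreover have "closed (K n)"
        using F by (auto simp: K_def)
      ultimately show ?thesis
        unfolding compact_eq_bounded_closed by (blast intro: bounded_subset[OF bounded_closed_interval])
    qed
    have Ks: "K n \<in> sets torus" for n
      using Kc Ksub by (auto simp: sets_restrict_space_iff compact_imp_closed)
    have Cs: "C \<in> sets torus"
      using sets.countable_UN[of K UNIV torus] Ks KC by auto
    have "(\<lambda>n. LINT x:K n|torus. f x) \<longlonglongrightarrow> (LINT x:(\<Union>n. K n)|torus. f x)"
    proof (rule set_integral_cont_up[OF Ks])
      show "incseq K"
        unfolding incseq_def K_def by (intro allI impI UN_mono) auto
      show "set_integrable torus (\<Union>n. K n) f"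
        unfolding set_integrable_def KC by (rule integrable_mult_indicator[OF Cs f(1)])
    qed
    moreover have "(LINT x:K n|torus. f x) = 0" for n
      unfolding set_lebesgue_integral_def by (rule fourier_vanish_integral_compact[OF f Kc Ksub])
    ultimately have "(\<lambda>n. 0) \<longlonglongrightarrow> (LINT x:C|torus. f x)"
      unfolding KC by simp
    then have "(LINT x:C|torus. f x) = 0"
      by (rule LIMSEQ_unique) (rule tendsto_const)
    moreover have "(LINT x:A|torus. f x) = (LINT x:C|torus. f x)"
    proof (rule set_integral_null_delta[OF f(1) A Cs])
      have "(A - C) \<union> (C - A) = T"
        using CT by (auto simp: disjnt_def)
      moreover have "T \<in> null_sets torus"
        using T CT sub by (subst null_sets_restrict_space) auto
      ultimately show "(A - C) \<union> (C - A) \<in> null_sets torus"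
        by simp
    qed
    ultimately show "(LINT x:A|torus. f x) = 0"
      by simp
  qed
qed

section \<open>Products of functions with decaying Fourier coefficients\<close>

text \<open>
  The decay rate of the Fourier coefficients of a function in \<open>H\<^sup>\<sigma>\<close>; as a weight it is the inverse
  square root of the one in the Sobolev norm.
\<close>

definition decay :: "real \<Rightarrow> int \<Rightarrow> real" where
  "decay \<sigma> k = (1 + (of_int k)\<^sup>2) powr (- \<sigma> / 2)"

lemma decay_pos: "decay \<sigma> k > 0"
  unfolding decay_def using zero_le_power2[of "real_of_int k"] by (simp add: add_nonneg_eq_0_iff)

lemma decay_minus [simp]: "decay \<sigma> (- k) = decay \<sigma> k"
  by (simp add: decay_def)

lemma decay_comparable:
  assumes "\<sigma> \<ge> 0" "\<bar>k\<bar> \<le> 2 * \<bar>m\<bar>"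
  shows "decay \<sigma> m \<le> 2 powr \<sigma> * decay \<sigma> k"
proof -
  have "\<bar>real_of_int k\<bar> \<le> \<bar>2 * real_of_int m\<bar>"
    using assms(2) by linarith
  then have "(real_of_int k)\<^sup>2 \<le> (2 * real_of_int m)\<^sup>2"
    by (simp only: abs_le_square_iff)
  then have le: "(1 + (real_of_int k)\<^sup>2) / 4 \<le> 1 + (real_of_int m)\<^sup>2"
    by (simp add: power_mult_distrib)
  have pos: "1 + (real_of_int k)\<^sup>2 > 0"
    using zero_le_power2[of "real_of_int k"] by linarith
  have "decay \<sigma> m \<le> ((1 + (real_of_int k)\<^sup>2) / 4) powr (- \<sigma> / 2)"
    unfolding decay_def using le assms(1) pos by (intro powr_mono2') auto
  also have "\<dots> = (1 + (real_of_int k)\<^sup>2) powr (- \<sigma> / 2) / 4 powr (- \<sigma> / 2)"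
    by (rule powr_divide)
  also have "4 powr (- \<sigma> / 2) = 1 / 2 powr \<sigma>"
  proof -
    have "(2 powr 2) powr (- \<sigma> / 2) = 2 powr (- \<sigma>)"
      by (simp only: powr_powr) simp
    then show ?thesis
      by (simp add: powr_minus_divide)
  qed
  finally show ?thesis
    by (simp add: decay_def mult.commute)
qed

text \<open>
  One of the frequencies \<open>l\<close> and \<open>k - l\<close> has at least half the size of \<open>k\<close>; its factor is
  comparable to \<open>decay \<sigma> k\<close>, and the other factor is summable over \<open>l\<close>.
\<close>

lemma decay_convolution:
  assumes "\<sigma> \<ge> 0"
  shows "decay \<sigma> l * decay \<sigma> (k - l) \<le> 2 powr \<sigma> * decay \<sigma> k * (decay \<sigma> l + decay \<sigma> (k - l))"
proof (cases "\<bar>k\<bar> \<le> 2 * \<bar>l\<bar>")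
  case True
  have "decay \<sigma> l * decay \<sigma> (k - l) \<le> (2 powr \<sigma> * decay \<sigma> k) * decay \<sigma> (k - l)"
    using decay_comparable[OF assms True] decay_pos[of \<sigma> "k - l"] by (intro mult_right_mono) auto
  also have "\<dots> \<le> (2 powr \<sigma> * decay \<sigma> k) * (decay \<sigma> l + decay \<sigma> (k - l))"
    using decay_pos[of \<sigma> l] decay_pos[of \<sigma> k] by (intro mult_left_mono) auto
  finally show ?thesis .
next
  case False
  then have *: "\<bar>k\<bar> \<le> 2 * \<bar>k - l\<bar>"
  proof -
    have "a \<le> 2 * c" if "\<not> a \<le> 2 * b" "a - b \<le> c" for a b c :: int
      using that by linarith
    from this[OF False abs_triangle_ineq2] show ?thesis .
  qed
  have "decay \<sigma> l * decay \<sigma> (k - l) \<le> decay \<sigma> l * (2 powr \<sigma> * decay \<sigma> k)"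
    using decay_comparable[OF assms *] decay_pos[of \<sigma> l] by (intro mult_left_mono) auto
  also have "\<dots> = (2 powr \<sigma> * decay \<sigma> k) * decay \<sigma> l"
    by simp
  also have "\<dots> \<le> (2 powr \<sigma> * decay \<sigma> k) * (decay \<sigma> l + decay \<sigma> (k - l))"
    using decay_pos[of \<sigma> "k - l"] decay_pos[of \<sigma> k] by (intro mult_left_mono) auto
  finally show ?thesis .
qed

lemma decay_summable_on:
  assumes "\<sigma> > 1"
  shows "decay \<sigma> summable_on UNIV"
proof -
  have "summable (\<lambda>n. decay \<sigma> (int n))"
  proof (rule summable_comparison_test')
    show "summable (\<lambda>n. real n powr (- \<sigma>))"
      using assms by (simp add: summable_real_powr_iff)
    show "norm (decay \<sigma> (int n)) \<le> real n powr (- \<sigma>)" if "n \<ge> 1" for n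
    proof -
      have "decay \<sigma> (int n) \<le> ((real n)\<^sup>2) powr (- \<sigma> / 2)"
        unfolding decay_def using that assms by (intro powr_mono2') auto
      also have "\<dots> = real n powr (- \<sigma>)"
        using that by (simp add: powr_powr flip: powr_numeral)
      finally show ?thesis
        using decay_pos[of \<sigma> "int n"] by simp
    qed
  qed
  then have nat: "(\<lambda>n. decay \<sigma> (int n)) summable_on UNIV"
    using decay_pos by (intro norm_summable_imp_summable_on) (simp add: less_imp_le abs_of_pos)
  have "decay \<sigma> summable_on range int"
    using nat by (subst summable_on_reindex) (auto simp: o_def)
  moreover have "decay \<sigma> summable_on range (\<lambda>n. - int n)"
    using nat by (subst summable_on_reindex) (auto simp: o_def inj_on_def)
  ultimately have "decay \<sigma> summable_on (range int \<union> range (\<lambda>n. - int n))"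
    by (rule summable_on_union)
  moreover have "range int \<union> range (\<lambda>n. - int n) = UNIV"
    by (auto intro: int_cases2)
  ultimately show ?thesis
    by simp
qed

lemma bij_int_decode: "bij int_decode"
  by (simp add: bij_def inj_int_decode surj_int_decode)

lemma sums_int_decode:
  fixes a :: "int \<Rightarrow> real"
  assumes "a summable_on UNIV"
  shows "(\<lambda>n. a (int_decode n)) sums infsum a UNIV"
  by (rule has_sum_imp_sums)
    (use has_sum_infsum[OF assms] has_sum_reindex_bij_betw[OF bij_int_decode, of a] in simp)

lemma sums_int_decode_reflect:
  fixes a :: "int \<Rightarrow> real"
  assumes "a summable_on UNIV"
  shows "(\<lambda>n. a (k - int_decode n)) sums infsum a UNIV"
proof -
  have "bij (\<lambda>l::int. k - l)"
    by (rule bij_betw_byWitness[where f'="\<lambda>l. k - l"]) auto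
  then have "((\<lambda>l. a (k - l)) has_sum infsum a UNIV) UNIV"
    using has_sum_infsum[OF assms] has_sum_reindex_bij_betw[of "\<lambda>l. k - l" UNIV UNIV a] by simp
  then show ?thesis
    using sums_int_decode[of "\<lambda>l. a (k - l)"] by (metis has_sum_imp_summable infsumI)
qed

text \<open>
  The sum of the series has the same Fourier coefficients as \<open>u\<close>, by term-by-term integration
  against the constant function \<open>1\<close>, and the coefficients determine a function.
\<close>

lemma AE_eq_fourier_series:
  assumes u: "integrable torus u" and s: "summable (\<lambda>n. norm (fourier_coeff u (int_decode n)))"
  shows "AE x in torus. u x = (\<Sum>n. fourier_coeff u (int_decode n) * cis (of_int (int_decode n) * x))"
proof -
  let ?g = "\<lambda>x. \<Sum>n. fourier_coeff u (int_decode n) * cis (of_int (int_decode n) * x)"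
  have meas: "?g \<in> borel_measurable torus"
    by (intro borel_measurable_suminf borel_measurable_times) auto
  note mult_one = fourier_coeff_mult_series[OF integrable_torus_const[of 1] s AE_I2[OF refl] meas]
  have g: "integrable torus ?g"
    using mult_one(1) by simp
  have "fourier_coeff ?g k = fourier_coeff u k" for k
  proof -
    have "(\<lambda>n. fourier_coeff u (int_decode n) * fourier_coeff (\<lambda>x. 1) (k - int_decode n)) sums fourier_coeff ?g k"
      using mult_one(2)[of k] by simp
    moreover have "(\<lambda>n. fourier_coeff u (int_decode n) * fourier_coeff (\<lambda>x. 1) (k - int_decode n)) =
        (\<lambda>n. if n = int_encode k then fourier_coeff u (int_decode n) else 0)"
      by (auto simp: fun_eq_iff fourier_coeff_const)
    ultimately show ?thesis
      using sums_single[of "int_encode k" "\<lambda>n. fourier_coeff u (int_decode n)"]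
      by (simp add: sums_unique2)
  qed
  then have "fourier_coeff (\<lambda>x. u x - ?g x) k = 0" for k
    using u g by (simp add: fourier_coeff_diff)
  from fourier_vanish_imp_AE_zero[OF _ this] u g show ?thesis
    by simp
qed

text \<open>
  The constant that results from summing the bound of \<open>decay_convolution\<close> over all \<open>l\<close>.
\<close>

definition convolution_const :: "real \<Rightarrow> real" where
  "convolution_const \<sigma> = 2 powr \<sigma> * (2 * infsum (decay \<sigma>) UNIV)"

lemma convolution_const_nonneg: "convolution_const \<sigma> \<ge> 0"
  unfolding convolution_const_def by (simp add: infsum_nonneg less_imp_le[OF decay_pos])

text \<open>
  The coefficients of a product are the convolution of the coefficients. For \<open>\<sigma> > 1\<close> those of \<open>g\<close> are
  absolutely summable, so \<open>g\<close> is given by its Fourier series, which is what the convolution formula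
  requires.
\<close>

lemma fourier_decay_mult:
  assumes \<sigma>: "\<sigma> > 1" and f: "integrable torus f" and g: "integrable torus g"
    and A: "\<And>k. norm (fourier_coeff f k) \<le> A * decay \<sigma> k"
    and B: "\<And>k. norm (fourier_coeff g k) \<le> B * decay \<sigma> k"
  shows "integrable torus (\<lambda>x. g x * f x)"
    and "norm (fourier_coeff (\<lambda>x. g x * f x) k) \<le> convolution_const \<sigma> * A * B * decay \<sigma> k"
proof -
  have nonneg: "0 \<le> A" "0 \<le> B"
    using order_trans[OF norm_ge_zero A] order_trans[OF norm_ge_zero B] decay_pos[of \<sigma> 0]
    by (metis zero_le_mult_iff not_less)+
  note sum = sums_int_decode[OF decay_summable_on[OF \<sigma>]] sums_int_decode_reflect[OF decay_summable_on[OF \<sigma>], of k]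
  have "summable (\<lambda>n. norm (fourier_coeff g (int_decode n)))"
    by (rule summable_comparison_test'[OF summable_mult[OF sums_summable[OF sum(1)], of B]]) (simp add: B)
  note series = fourier_coeff_mult_series[OF f this AE_eq_fourier_series[OF g this] borel_measurable_integrable[OF g]]
  from series(1) show "integrable torus (\<lambda>x. g x * f x)" .
  let ?c = "\<lambda>n. fourier_coeff g (int_decode n) * fourier_coeff f (k - int_decode n)"
  let ?d = "\<lambda>n. A * B * (2 powr \<sigma> * decay \<sigma> k) * (decay \<sigma> (int_decode n) + decay \<sigma> (k - int_decode n))"
  have bound: "norm (?c n) \<le> ?d n" for n
  proof -
    have "norm (?c n) \<le> (B * decay \<sigma> (int_decode n)) * (A * decay \<sigma> (k - int_decode n))"
      unfolding norm_mult using A B nonneg decay_pos by (intro mult_mono) (auto simp: less_imp_le)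
    also have "\<dots> = A * B * (decay \<sigma> (int_decode n) * decay \<sigma> (k - int_decode n))"
      by simp
    also have "\<dots> \<le> A * B * (2 powr \<sigma> * decay \<sigma> k * (decay \<sigma> (int_decode n) + decay \<sigma> (k - int_decode n)))"
      using \<sigma> nonneg by (intro mult_left_mono decay_convolution) auto
    finally show ?thesis
      by (simp add: mult.assoc)
  qed
  have d: "?d sums (convolution_const \<sigma> * A * B * decay \<sigma> k)"
    using sums_mult[OF sums_add[OF sum], of "A * B * (2 powr \<sigma> * decay \<sigma> k)"]
    by (simp add: convolution_const_def mult_ac)
  have "norm (suminf ?c) \<le> suminf ?d"
    using bound sums_summable[OF d] by (rule norm_suminf_le)
  then show "norm (fourier_coeff (\<lambda>x. g x * f x) k) \<le> convolution_const \<sigma> * A * B * decay \<sigma> k"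
    using sums_unique[OF d] sums_unique[OF series(2)] by simp
qed

text \<open>
  The nonlinearity is the product of \<open>v\<close>, \<open>cnj v\<close> and \<open>v\<close>, and conjugation preserves the decay.
\<close>

lemma fourier_decay_cubic:
  assumes \<sigma>: "\<sigma> > 1" and v: "integrable torus v"
    and M: "\<And>k. norm (fourier_coeff v k) \<le> M * decay \<sigma> k"
  shows "integrable torus (\<lambda>x. (of_real (norm (v x)))\<^sup>2 * v x)"
    and "norm (fourier_coeff (\<lambda>x. (of_real (norm (v x)))\<^sup>2 * v x) k)
      \<le> (convolution_const \<sigma>)\<^sup>2 * M ^ 3 * decay \<sigma> k"
proof -
  have cnj: "integrable torus (\<lambda>x. cnj (v x))"
    "\<And>k. norm (fourier_coeff (\<lambda>x. cnj (v x)) k) \<le> M * decay \<sigma> k"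
    using v M[of "- k" for k] by (auto simp: fourier_coeff_cnj)
  note sq = fourier_decay_mult[OF \<sigma> v cnj(1) M cnj(2)]
  note cube = fourier_decay_mult[OF \<sigma> sq(1) v sq(2) M]
  have eq: "(\<lambda>x. (of_real (norm (v x)))\<^sup>2 * v x) = (\<lambda>x. v x * (cnj (v x) * v x))"
    by (simp add: fun_eq_iff complex_norm_square mult_ac flip: of_real_power)
  show "integrable torus (\<lambda>x. (of_real (norm (v x)))\<^sup>2 * v x)"
    unfolding eq by (rule cube(1))
  show "norm (fourier_coeff (\<lambda>x. (of_real (norm (v x)))\<^sup>2 * v x) k)
      \<le> (convolution_const \<sigma>)\<^sup>2 * M ^ 3 * decay \<sigma> k"
    unfolding eq using cube(2)[of k] by (simp add: power2_eq_square power3_eq_cube mult_ac)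
qed

section \<open>Sobolev spaces\<close>

lemma torus_L2_imp_integrable:
  assumes "f \<in> torus_L2"
  shows "integrable torus f"
proof (rule Bochner_Integration.integrable_bound)
  show "integrable torus (\<lambda>x. 1 + (norm (f x))\<^sup>2)"
    using assms finite_measure_torus by (simp add: torus_L2_def finite_measure.integrable_const)
  have "a \<le> 1 + a\<^sup>2" for a :: real
  proof -
    have "2 * a \<le> 1 + a\<^sup>2"
      using zero_le_power2[of "a - 1"] by (simp add: power2_eq_square algebra_simps)
    then show ?thesis
      using zero_le_power2[of a] by linarith
  qed
  then show "AE x in torus. norm (f x) \<le> norm (1 + (norm (f x))\<^sup>2)"
    by simp
qed (use assms in \<open>simp add: torus_L2_def\<close>)

lemma norm_diff_power2_le: "(norm (a - b))\<^sup>2 \<le> 2 * (norm a)\<^sup>2 + 2 * (norm b)\<^sup>2"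
  for a b :: "'a::real_normed_vector"
proof -
  have "(norm (a - b))\<^sup>2 \<le> (norm a + norm b)\<^sup>2"
    by (intro power_mono norm_triangle_ineq4) simp
  also have "\<dots> \<le> 2 * (norm a)\<^sup>2 + 2 * (norm b)\<^sup>2"
    using zero_le_power2[of "norm a - norm b"] by (simp add: power2_eq_square algebra_simps)
  finally show ?thesis .
qed

lemma sobolev_imp_integrable: "f \<in> sobolev \<sigma> \<Longrightarrow> integrable torus f"
  by (simp add: sobolev_def torus_L2_imp_integrable)

lemma torus_L2_diff:
  assumes "f \<in> torus_L2" "g \<in> torus_L2"
  shows "(\<lambda>x. f x - g x) \<in> torus_L2"
proof -
  have meas: "(\<lambda>x. f x - g x) \<in> borel_measurable torus"
    using assms by (auto simp: torus_L2_def)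
  have "integrable torus (\<lambda>x. (norm (f x - g x))\<^sup>2)"
  proof (rule Bochner_Integration.integrable_bound)
    show "integrable torus (\<lambda>x. 2 * (norm (f x))\<^sup>2 + 2 * (norm (g x))\<^sup>2)"
      using assms by (simp add: torus_L2_def)
  qed (use meas norm_diff_power2_le[of "f _" "g _"] in auto)
  with meas show ?thesis
    by (simp add: torus_L2_def)
qed

text \<open>
  The norm of a difference of two elements is thereby a genuine (convergent) sum, so that
  \<open>sobolev_dist\<close> controls differences of Fourier coefficients.
\<close>

lemma sobolev_diff:
  assumes f: "f \<in> sobolev \<sigma>" and g: "g \<in> sobolev \<sigma>"
  shows "(\<lambda>x. f x - g x) \<in> sobolev \<sigma>"
proof -
  let ?w = "\<lambda>k::int. (1 + (of_int k)\<^sup>2) powr \<sigma> :: real"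
  have "(\<lambda>k. 2 * (?w k * (norm (fourier_coeff f k))\<^sup>2) + 2 * (?w k * (norm (fourier_coeff g k))\<^sup>2)) summable_on UNIV"
    using f g by (intro summable_on_add summable_on_cmult_right) (auto simp: sobolev_def)
  then have "(\<lambda>k. ?w k * (norm (fourier_coeff (\<lambda>x. f x - g x) k))\<^sup>2) summable_on UNIV"
  proof (rule summable_on_comparison_test)
    fix k
    have "?w k * (norm (fourier_coeff f k - fourier_coeff g k))\<^sup>2
        \<le> ?w k * (2 * (norm (fourier_coeff f k))\<^sup>2 + 2 * (norm (fourier_coeff g k))\<^sup>2)"
      by (intro mult_left_mono norm_diff_power2_le) simp
    then show "?w k * (norm (fourier_coeff (\<lambda>x. f x - g x) k))\<^sup>2
        \<le> 2 * (?w k * (norm (fourier_coeff f k))\<^sup>2) + 2 * (?w k * (norm (fourier_coeff g k))\<^sup>2)"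
      using f g by (simp add: fourier_coeff_diff sobolev_imp_integrable algebra_simps)
  qed simp
  then show ?thesis
    using f g by (auto simp: sobolev_def intro: torus_L2_diff)
qed

lemma fourier_coeff_le_sobolev_norm:
  assumes "f \<in> sobolev \<sigma>"
  shows "norm (fourier_coeff f k) \<le> sobolev_norm \<sigma> f * decay \<sigma> k"
proof -
  let ?w = "\<lambda>k::int. (1 + (of_int k)\<^sup>2) powr \<sigma> * (norm (fourier_coeff f k))\<^sup>2"
  have "sum ?w {k} \<le> infsum ?w UNIV"
    using assms by (intro finite_sum_le_infsum) (auto simp: sobolev_def)
  moreover have "?w k = (norm (fourier_coeff f k) / decay \<sigma> k)\<^sup>2"
    by (simp add: decay_def power_divide powr_minus divide_simps flip: powr_numeral) (simp add: powr_powr)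
  ultimately have "(norm (fourier_coeff f k) / decay \<sigma> k)\<^sup>2 \<le> infsum ?w UNIV"
    by simp
  then have "norm (fourier_coeff f k) / decay \<sigma> k \<le> sobolev_norm \<sigma> f"
    unfolding sobolev_norm_def by (rule real_le_rsqrt)
  then show ?thesis
    using decay_pos[of \<sigma> k] by (simp add: divide_simps)
qed

lemma fourier_coeff_diff_le_sobolev_dist:
  assumes "f \<in> sobolev \<sigma>" "g \<in> sobolev \<sigma>"
  shows "norm (fourier_coeff f k - fourier_coeff g k) \<le> sobolev_dist \<sigma> f g * decay \<sigma> k"
  using fourier_coeff_le_sobolev_norm[OF sobolev_diff[OF assms], of k] assms
  by (simp add: sobolev_dist_def fourier_coeff_diff sobolev_imp_integrable)

lemma const_weighted_coeffs:
  "(\<lambda>k::int. (1 + (of_int k)\<^sup>2) powr \<sigma> * (norm (fourier_coeff (\<lambda>x. c) k))\<^sup>2) =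
    (\<lambda>k. if k = 0 then (norm c)\<^sup>2 else 0)"
  by (simp add: fun_eq_iff fourier_coeff_const)

lemma sobolev_const: "(\<lambda>x. c) \<in> sobolev \<sigma>"
proof -
  have "(\<lambda>k::int. if k = 0 then (norm c)\<^sup>2 else 0) summable_on UNIV"
    by (rule finite_nonzero_values_imp_summable_on) simp
  moreover have "(\<lambda>x. c) \<in> torus_L2"
    using finite_measure_torus by (simp add: torus_L2_def finite_measure.integrable_const)
  ultimately show ?thesis
    unfolding sobolev_def mem_Collect_eq const_weighted_coeffs by blast
qed

lemma sobolev_norm_const: "sobolev_norm \<sigma> (\<lambda>x. c) = norm c"
proof -
  have "(\<Sum>\<^sub>\<infinity>k::int. if k = 0 then (norm c)\<^sup>2 else 0) = (\<Sum>\<^sub>\<infinity>k\<in>{0::int}. (norm c)\<^sup>2)"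
    by (rule infsum_cong_neutral) auto
  then show ?thesis
    unfolding sobolev_norm_def const_weighted_coeffs by simp
qed

lemma sobolev_dist_self: "sobolev_dist \<sigma> f f = 0"
  using sobolev_norm_const[of \<sigma> 0] by (simp add: sobolev_dist_def)

section \<open>A lacunary potential\<close>

definition lacunary :: "real \<Rightarrow> real \<Rightarrow> real" where
  "lacunary \<alpha> x = (\<Sum>j. (2 powr - \<alpha>) ^ j * cos (2 ^ j * x))"

context
  fixes \<alpha> :: real
  assumes \<alpha>: "\<alpha> > 0"
begin

lemma ratio: "0 < 2 powr - \<alpha>" "2 powr - \<alpha> < 1"
  using \<alpha> powr_less_mono[of "-\<alpha>" 0 2] by simp_all

lemma summable_ratio: "summable (\<lambda>j. (2 powr - \<alpha>) ^ j)"
  using ratio by (intro summable_geometric) simp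

lemma fourier_coeff_lacunary_mult:
  assumes f: "integrable torus f"
  shows "integrable torus (\<lambda>x. of_real (lacunary \<alpha> x) * f x)"
    and "(\<lambda>j. of_real ((2 powr - \<alpha>) ^ j / 2) * (fourier_coeff f (k - 2 ^ j) + fourier_coeff f (k + 2 ^ j)))
      sums fourier_coeff (\<lambda>x. of_real (lacunary \<alpha> x) * f x) k"
proof -
  let ?b = "\<lambda>j. complex_of_real ((2 powr - \<alpha>) ^ j / 2)"
  define g where "g m x = (\<Sum>j. ?b j * cis (of_int (m j) * x))" for m :: "nat \<Rightarrow> int" and x
  have b: "summable (\<lambda>j. norm (?b j))"
    using summable_divide[OF summable_ratio, of 2] ratio by (simp add: norm_divide norm_power)
  have meas: "g m \<in> borel_measurable torus" for m
    unfolding g_def by (intro borel_measurable_suminf borel_measurable_times) auto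
  have sm: "summable (\<lambda>j. ?b j * cis (of_int (m j) * x))" for m x
    by (rule summable_norm_cancel) (use b in \<open>simp add: norm_mult\<close>)
  note series = fourier_coeff_mult_series[OF f b AE_I2[OF g_def] meas]
  have eq: "of_real (lacunary \<alpha> x) * f x = g (\<lambda>j. 2 ^ j) x * f x + g (\<lambda>j. - (2 ^ j)) x * f x" for x
  proof -
    have euler: "complex_of_real ((2 powr - \<alpha>) ^ j * cos (2 ^ j * x))
        = ?b j * cis (of_int (2 ^ j) * x) + ?b j * cis (of_int (- (2 ^ j)) * x)" for j
      by (simp add: complex_eq_iff)
    have "summable (\<lambda>j. (2 powr - \<alpha>) ^ j * cos (2 ^ j * x))"
      by (rule summable_comparison_test'[OF summable_ratio]) (use ratio in \<open>auto simp: abs_mult intro!: mult_left_le\<close>)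
    then have "of_real (lacunary \<alpha> x) = (\<Sum>j. complex_of_real ((2 powr - \<alpha>) ^ j * cos (2 ^ j * x)))"
      unfolding lacunary_def by (rule suminf_of_real)
    also have "\<dots> = g (\<lambda>j. 2 ^ j) x + g (\<lambda>j. - (2 ^ j)) x"
      unfolding g_def euler by (rule suminf_add[symmetric, OF sm sm])
    finally show ?thesis
      by (simp add: distrib_right)
  qed
  show "integrable torus (\<lambda>x. of_real (lacunary \<alpha> x) * f x)"
    unfolding eq by (intro Bochner_Integration.integrable_add series(1))
  show "(\<lambda>j. ?b j * (fourier_coeff f (k - 2 ^ j) + fourier_coeff f (k + 2 ^ j)))
      sums fourier_coeff (\<lambda>x. of_real (lacunary \<alpha> x) * f x) k"
    unfolding eq using sums_add[OF series(2)[of k "\<lambda>j. 2 ^ j"] series(2)[of k "\<lambda>j. - (2 ^ j)"]]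
    by (simp add: fourier_coeff_add series(1) distrib_left)
qed

lemma fourier_coeff_lacunary:
  "fourier_coeff (\<lambda>x. of_real (lacunary \<alpha> x)) (2 ^ i) = of_real ((2 powr - \<alpha>) ^ i / 2)"
  "fourier_coeff (\<lambda>x. of_real (lacunary \<alpha> x)) (- (2 ^ i)) = of_real ((2 powr - \<alpha>) ^ i / 2)"
  "k \<notin> range (\<lambda>i. 2 ^ i) \<union> range (\<lambda>i. - (2 ^ i)) \<Longrightarrow> fourier_coeff (\<lambda>x. of_real (lacunary \<alpha> x)) k = 0"
proof -
  let ?b = "\<lambda>j. complex_of_real ((2 powr - \<alpha>) ^ j / 2)"
  have S: "(\<lambda>j. ?b j * ((if k = 2 ^ j then 1 else 0) + (if k = - (2 ^ j) then 1 else 0)))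
      sums fourier_coeff (\<lambda>x. of_real (lacunary \<alpha> x)) k" for k
    using fourier_coeff_lacunary_mult(2)[OF integrable_torus_const[of 1], of k] by (simp add: fourier_coeff_const add_eq_0_iff2)
  have pos: "(0::int) < 2 ^ j" for j :: nat
    by simp
  have ne: "(2::int) ^ i \<noteq> - (2 ^ j)" "- ((2::int) ^ i) \<noteq> 2 ^ j" for i j
    using pos[of i] pos[of j] by linarith+
  have eq: "(2::int) ^ i = 2 ^ j \<longleftrightarrow> j = i" for i j
    by auto
  have "(\<lambda>j. ?b j * ((if (2::int) ^ i = 2 ^ j then 1 else 0) + (if (2::int) ^ i = - (2 ^ j) then 1 else 0)))
      = (\<lambda>j. if j = i then ?b j else 0)"
    by (rule ext) (simp only: neg_equal_iff_equal ne eq if_False, simp)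
  from sums_unique2[OF S[of "2 ^ i", unfolded this] sums_single] show "fourier_coeff (\<lambda>x. of_real (lacunary \<alpha> x)) (2 ^ i) = ?b i" .
  have "(\<lambda>j. ?b j * ((if - ((2::int) ^ i) = 2 ^ j then 1 else 0) + (if - ((2::int) ^ i) = - (2 ^ j) then 1 else 0)))
      = (\<lambda>j. if j = i then ?b j else 0)"
    by (rule ext) (simp only: neg_equal_iff_equal ne eq if_False, simp)
  from sums_unique2[OF S[of "- (2 ^ i)", unfolded this] sums_single] show "fourier_coeff (\<lambda>x. of_real (lacunary \<alpha> x)) (- (2 ^ i)) = ?b i" .
  assume "k \<notin> range (\<lambda>i. 2 ^ i) \<union> range (\<lambda>i. - (2 ^ i))"
  then have "(\<lambda>j. ?b j * ((if k = 2 ^ j then 1 else 0) + (if k = - (2 ^ j) then 1 else 0))) = (\<lambda>j. 0)"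
    by (auto simp: fun_eq_iff)
  from sums_unique2[OF S[of k, unfolded this] sums_zero]
  show "fourier_coeff (\<lambda>x. of_real (lacunary \<alpha> x)) k = 0" .
qed

text \<open>
  The squared norm is up to constants the geometric series with ratio \<open>2 powr (2 * s - 2 * \<alpha>)\<close>.
\<close>

lemma lacunary_in_sobolev:
  assumes "0 \<le> s" "s < \<alpha>"
  shows "(\<lambda>x. complex_of_real (lacunary \<alpha> x)) \<in> sobolev s"
proof -
  let ?q = "2 powr - \<alpha>" and ?\<xi> = "\<lambda>x. complex_of_real (lacunary \<alpha> x)"
  have meas: "?\<xi> \<in> borel_measurable torus"
    using fourier_coeff_lacunary_mult(1)[OF integrable_torus_const[of 1]] by auto
  have le: "\<bar>lacunary \<alpha> x\<bar> \<le> (\<Sum>j. ?q ^ j)" for x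
    unfolding lacunary_def using norm_suminf_le[OF _ summable_ratio, of "\<lambda>j. ?q ^ j * cos (2 ^ j * x)"] ratio
    by (auto simp: abs_mult intro!: mult_left_le)
  have L2: "?\<xi> \<in> torus_L2"
  proof -
    have "integrable torus (\<lambda>x. (norm (?\<xi> x))\<^sup>2)"
    proof (rule finite_measure.integrable_const_bound[OF finite_measure_torus])
      show "AE x in torus. norm ((norm (?\<xi> x))\<^sup>2) \<le> (\<Sum>j. ?q ^ j)\<^sup>2"
        using power_mono[OF le abs_ge_zero, of _ 2] by (intro AE_I2) simp
    qed (rule borel_measurable_power[OF measurable_compose[OF meas borel_measurable_norm]])
    then show ?thesis
      using meas by (simp add: torus_L2_def)
  qed
  let ?w = "\<lambda>k::int. (1 + (of_int k)\<^sup>2) powr s * (norm (fourier_coeff ?\<xi> k))\<^sup>2"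
  have "summable (\<lambda>j. (1 + (2 ^ j)\<^sup>2) powr s * (?q ^ j / 2)\<^sup>2)"
  proof (rule summable_comparison_test')
    have "2 powr (2 * s - 2 * \<alpha>) < 1"
      using assms powr_less_mono[of "2 * s - 2 * \<alpha>" 0 2] by simp
    then show "summable (\<lambda>j. 2 powr s * (2 powr (2 * s - 2 * \<alpha>)) ^ j)"
      by (intro summable_mult summable_geometric) simp
    show "norm ((1 + (2 ^ j)\<^sup>2) powr s * (?q ^ j / 2)\<^sup>2) \<le> 2 powr s * (2 powr (2 * s - 2 * \<alpha>)) ^ j" for j :: nat
    proof -
      have "(1::real) \<le> (2 ^ j)\<^sup>2"
        by (simp add: one_le_power)
      then have "(1 + (2 ^ j)\<^sup>2) powr s \<le> (2 * (2 ^ j)\<^sup>2 :: real) powr s"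
        using assms by (intro powr_mono2) auto
      also have "\<dots> = 2 powr s * 2 powr (2 * s * j)"
        by (simp add: powr_mult powr_powr powr_realpow[symmetric] mult_ac flip: powr_numeral)
      finally have "(1 + (2 ^ j)\<^sup>2) powr s * (?q ^ j / 2)\<^sup>2 \<le> (2 powr s * 2 powr (2 * s * j)) * (?q ^ j)\<^sup>2"
        by (intro mult_mono) (auto simp: power_divide)
      also have "(?q ^ j)\<^sup>2 = 2 powr (- 2 * \<alpha> * j)"
        by (simp add: powr_powr powr_realpow[symmetric] mult_ac flip: powr_numeral)
      also have "(2 powr s * 2 powr (2 * s * j)) * 2 powr (- 2 * \<alpha> * j) = 2 powr s * (2 powr (2 * s - 2 * \<alpha>)) ^ j"
        by (simp add: powr_powr powr_realpow[symmetric] powr_add[symmetric] algebra_simps)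
      finally show ?thesis
        by simp
    qed
  qed
  then have nat: "(\<lambda>j. (1 + (2 ^ j)\<^sup>2) powr s * (?q ^ j / 2)\<^sup>2) summable_on UNIV"
    by (intro norm_summable_imp_summable_on) simp
  have "?w summable_on range (\<lambda>i. 2 ^ i)" "?w summable_on range (\<lambda>i. - (2 ^ i))"
    using nat ratio
    by (subst summable_on_reindex, auto simp: o_def inj_on_def fourier_coeff_lacunary norm_divide norm_power)+
  then have "?w summable_on (range (\<lambda>i. 2 ^ i) \<union> range (\<lambda>i. - (2 ^ i)))"
    by (rule summable_on_union)
  then have "?w summable_on UNIV"
    by (rule summable_on_cong_neutral[THEN iffD1, rotated -1]) (auto simp: fourier_coeff_lacunary(3))
  then show ?thesis
    using L2 by (simp add: sobolev_def)
qed

text \<open>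
  In the coefficient of the product at \<open>2 ^ J\<close> the potential pairs its frequencies \<open>\<plusminus> 2 ^ j\<close> with
  the coefficients of \<open>v\<close> at \<open>2 ^ J \<mp> 2 ^ j\<close>. This frequency is \<open>0\<close> only for the resonant choice
  \<open>+ 2 ^ J\<close>; otherwise lacunarity makes it at least half as large as \<open>2 ^ J\<close>.
\<close>

lemma fourier_coeff_lacunary_mult_resonance:
  assumes \<sigma>: "\<sigma> \<ge> 0" and v: "integrable torus v" and M: "\<And>k. norm (fourier_coeff v k) \<le> M * decay \<sigma> k"
  shows "norm (fourier_coeff (\<lambda>x. of_real (lacunary \<alpha> x) * v x) (2 ^ J)
      - of_real ((2 powr - \<alpha>) ^ J / 2) * fourier_coeff v 0)
    \<le> 2 powr \<sigma> / (1 - 2 powr - \<alpha>) * M * decay \<sigma> (2 ^ J)"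
proof -
  let ?q = "2 powr - \<alpha>"
  let ?b = "\<lambda>j. complex_of_real (?q ^ j / 2)"
  let ?B = "M * (2 powr \<sigma> * decay \<sigma> (2 ^ J))"
  have M0: "0 \<le> M"
    using order_trans[OF norm_ge_zero M] decay_pos[of \<sigma> 0] by (metis zero_le_mult_iff not_less)
  \<comment> \<open>The terms of the series for the coefficient at \<open>2 ^ J\<close>, with the resonant contribution removed.\<close>
  define d where "d j = ?b j * (fourier_coeff v (2 ^ J - 2 ^ j) + fourier_coeff v (2 ^ J + 2 ^ j))
      - (if j = J then ?b J * fourier_coeff v 0 else 0)" for j
  have d: "d sums (fourier_coeff (\<lambda>x. of_real (lacunary \<alpha> x) * v x) (2 ^ J) - ?b J * fourier_coeff v 0)"
    unfolding d_def
    by (intro sums_diff fourier_coeff_lacunary_mult(2)[OF v] sums_single[of J "\<lambda>_. ?b J * fourier_coeff v 0"])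
  have far: "norm (fourier_coeff v m) \<le> ?B" if "2 ^ J \<le> 2 * \<bar>m\<bar>" for m
    using order_trans[OF M mult_left_mono[OF decay_comparable[OF \<sigma>] M0]] that by simp
  have bound: "norm (d j) \<le> ?q ^ j * ?B" for j
  proof -
    have plus: "norm (fourier_coeff v (2 ^ J + 2 ^ j)) \<le> ?B"
      by (rule far) (simp add: abs_of_pos add_pos_pos)
    have B0: "0 \<le> ?B"
      using plus norm_ge_zero order_trans by blast
    have nb: "norm (?b j) = ?q ^ j / 2"
      using ratio by (simp add: norm_divide norm_power)
    show ?thesis
    proof (cases "j = J")
      case True
      then have "norm (d j) = ?q ^ j / 2 * norm (fourier_coeff v (2 ^ J + 2 ^ j))"
        using nb by (simp add: d_def distrib_left norm_mult)
      also have "\<dots> \<le> ?q ^ j * ?B"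
        using plus ratio by (intro mult_mono) auto
      finally show ?thesis .
    next
      case False
      have "(2::int) ^ J \<le> 2 * \<bar>2 ^ J - 2 ^ j\<bar>"
      proof -
        have *: "a \<le> 2 * \<bar>a - b\<bar>" if "2 * b \<le> a \<or> 2 * a \<le> b" "0 \<le> a" for a b :: int
          using that by arith
        have "2 * (2::int) ^ j \<le> 2 ^ J \<or> 2 * (2::int) ^ J \<le> 2 ^ j"
          using False power_increasing[of "Suc j" J "2::int"] power_increasing[of "Suc J" j "2::int"]
          by (cases "j < J") auto
        then show ?thesis
          by (rule *) simp
      qed
      from far[OF this] plus
      have "norm (fourier_coeff v (2 ^ J - 2 ^ j) + fourier_coeff v (2 ^ J + 2 ^ j)) \<le> 2 * ?B"
        by (intro order_trans[OF norm_triangle_ineq]) linarith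
      then have "norm (d j) \<le> ?q ^ j / 2 * (2 * ?B)"
        unfolding d_def using False nb ratio by (simp add: norm_mult mult_left_mono)
      then show ?thesis by simp
    qed
  qed
  have "(\<lambda>j. ?q ^ j * ?B) sums (1 / (1 - ?q) * ?B)"
    using ratio by (intro sums_mult2 geometric_sums) simp
  with bound have "norm (suminf d) \<le> 1 / (1 - ?q) * ?B"
    using norm_suminf_le[of d "\<lambda>j. ?q ^ j * ?B"] by (metis sums_summable sums_unique)
  then show ?thesis
    using sums_unique[OF d] by (simp add: mult_ac)
qed

end

lemma forcing_resonance:
  assumes \<alpha>: "\<alpha> > 0" and \<sigma>: "\<sigma> > 1" and v: "integrable torus v"
    and M: "\<And>k. norm (fourier_coeff v k) \<le> M * decay \<sigma> k"
  shows "norm (fourier_coeff (forcing (lacunary \<alpha>) lam v) (2 ^ J)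
      - of_real ((2 powr - \<alpha>) ^ J / 2) * fourier_coeff v 0)
    \<le> (2 powr \<sigma> / (1 - 2 powr - \<alpha>) * M + \<bar>lam\<bar> * ((convolution_const \<sigma>)\<^sup>2 * M ^ 3)) * decay \<sigma> (2 ^ J)"
proof -
  let ?\<xi>v = "\<lambda>x. complex_of_real (lacunary \<alpha> x) * v x" and ?c = "\<lambda>x. (complex_of_real (norm (v x)))\<^sup>2 * v x"
  have tri: "norm (a - of_real lam * b - d) \<le> norm (a - d) + \<bar>lam\<bar> * norm b" for a b d :: complex
  proof -
    have "a - of_real lam * b - d = (a - d) - of_real lam * b"
      by simp
    then show ?thesis
      using norm_triangle_ineq4[of "a - d" "of_real lam * b"] by (simp only: norm_mult norm_of_real)
  qed
  have "forcing (lacunary \<alpha>) lam v = (\<lambda>x. ?\<xi>v x - of_real lam * ?c x)"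
    by (simp add: fun_eq_iff forcing_def mult.assoc)
  then have "fourier_coeff (forcing (lacunary \<alpha>) lam v) (2 ^ J)
      = fourier_coeff ?\<xi>v (2 ^ J) - of_real lam * fourier_coeff ?c (2 ^ J)"
    using fourier_coeff_lacunary_mult(1)[OF \<alpha> v] fourier_decay_cubic(1)[OF \<sigma> v M]
    by (simp only:) (subst fourier_coeff_diff, simp_all add: fourier_coeff_cmult)
  then have "norm (fourier_coeff (forcing (lacunary \<alpha>) lam v) (2 ^ J) - of_real ((2 powr - \<alpha>) ^ J / 2) * fourier_coeff v 0)
    \<le> norm (fourier_coeff ?\<xi>v (2 ^ J) - of_real ((2 powr - \<alpha>) ^ J / 2) * fourier_coeff v 0)
      + \<bar>lam\<bar> * norm (fourier_coeff ?c (2 ^ J))"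
    using tri by simp
  also have "\<dots> \<le> 2 powr \<sigma> / (1 - 2 powr - \<alpha>) * M * decay \<sigma> (2 ^ J)
      + \<bar>lam\<bar> * ((convolution_const \<sigma>)\<^sup>2 * M ^ 3 * decay \<sigma> (2 ^ J))"
    using \<sigma> by (intro add_mono mult_left_mono fourier_coeff_lacunary_mult_resonance[OF \<alpha> _ v M]
        fourier_decay_cubic(2)[OF _ v M]) auto
  finally show ?thesis
    by (simp add: algebra_simps)
qed

section \<open>Non-existence of solutions with constant data\<close>

lemma cos_ge_half:
  fixes \<theta> :: real
  assumes "\<bar>\<theta>\<bar> \<le> 1"
  shows "cos \<theta> \<ge> 1 / 2"
proof -
  have "cos (pi / 3) \<le> cos \<bar>\<theta>\<bar>"
    using assms pi_gt3 by (intro cos_monotone_0_pi_le) auto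
  then show ?thesis
    by (simp add: cos_60)
qed

text \<open>
  While the phase \<open>\<theta>\<close> has turned by at most one radian, which is less than \<open>pi / 3\<close>, the real part of
  \<open>\<epsilon> * cis \<theta>\<close> is at least \<open>\<epsilon> / 2\<close>; the error in \<open>c\<close> costs half of that.
\<close>

lemma Re_cis_mult_ge:
  assumes "\<bar>\<theta>\<bar> \<le> 1" "norm (c - of_real \<epsilon>) \<le> \<epsilon> / 4"
  shows "Re (cis \<theta> * c) \<ge> \<epsilon> / 4"
proof -
  have \<epsilon>: "\<epsilon> \<ge> 0"
    using order_trans[OF norm_ge_zero assms(2)] by simp
  have "cis \<theta> * c = of_real \<epsilon> * cis \<theta> + cis \<theta> * (c - of_real \<epsilon>)"
    by (simp add: algebra_simps)
  then have "Re (cis \<theta> * c) = \<epsilon> * cos \<theta> + Re (cis \<theta> * (c - of_real \<epsilon>))"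
    by simp
  moreover have "\<bar>Re (cis \<theta> * (c - of_real \<epsilon>))\<bar> \<le> \<epsilon> / 4"
  proof (rule order_trans[OF abs_Re_le_cmod])
    show "norm (cis \<theta> * (c - of_real \<epsilon>)) \<le> \<epsilon> / 4"
      using assms(2) by (simp add: norm_mult)
  qed
  moreover have "\<epsilon> * (1 / 2) \<le> \<epsilon> * cos \<theta>"
    using \<epsilon> cos_ge_half[OF assms(1)] by (intro mult_left_mono) auto
  ultimately show ?thesis
    by linarith
qed

lemma Re_set_integral_ge:
  fixes X :: "real \<Rightarrow> complex"
  assumes t: "0 \<le> t" and X: "set_integrable lebesgue {0..t} X"
    and ge: "\<And>\<rho>. \<rho> \<in> {0..t} \<Longrightarrow> b \<le> Re (X \<rho>)"
  shows "t * b \<le> norm (LINT \<rho>:{0..t}|lebesgue. X \<rho>)"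
proof -
  have Re: "set_integrable lebesgue {0..t} (\<lambda>\<rho>. Re (X \<rho>))"
      "(LINT \<rho>:{0..t}|lebesgue. Re (X \<rho>)) = Re (LINT \<rho>:{0..t}|lebesgue. X \<rho>)"
    using X integrable_Re[of lebesgue "\<lambda>x. indicator {0..t} x *\<^sub>R X x"]
      integral_Re[of lebesgue "\<lambda>x. indicator {0..t} x *\<^sub>R X x"]
    by (simp_all add: set_integrable_def set_lebesgue_integral_def)
  have "t * b = (LINT \<rho>:{0..t}|lebesgue. b)"
    using t by (simp add: set_lebesgue_integral_def)
  also have "\<dots> \<le> (LINT \<rho>:{0..t}|lebesgue. Re (X \<rho>))"
    using ge t by (intro set_integral_mono Re(1)) (auto simp: set_integrable_def intro!: integrable_real_indicator)
  also have "\<dots> \<le> norm (LINT \<rho>:{0..t}|lebesgue. X \<rho>)"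
    unfolding Re(2) by (rule complex_Re_le_cmod)
  finally show ?thesis .
qed

lemma C01_sobolev_near_start:
  assumes u: "u \<in> C01_sobolev \<sigma>" and "\<eta> > 0"
  obtains \<tau> where "\<tau> > 0" "\<And>t. 0 \<le> t \<Longrightarrow> t \<le> 1 \<Longrightarrow> t < \<tau> \<Longrightarrow> sobolev_dist \<sigma> (u t) (u 0) < \<eta>"
proof -
  have "((\<lambda>r. sobolev_dist \<sigma> (u r) (u 0)) \<longlongrightarrow> 0) (at 0 within {0..1})"
    using u by (simp add: C01_sobolev_def)
  from order_tendstoD(2)[OF this \<open>\<eta> > 0\<close>]
  obtain \<tau> where "\<tau> > 0" and \<tau>: "\<And>t. t \<in> {0..1} \<Longrightarrow> t \<noteq> 0 \<Longrightarrow> dist t 0 < \<tau> \<Longrightarrow> sobolev_dist \<sigma> (u t) (u 0) < \<eta>"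
    unfolding eventually_at by blast
  show thesis
  proof (rule that[OF \<open>\<tau> > 0\<close>])
    fix t :: real assume "0 \<le> t" "t \<le> 1" "t < \<tau>"
    then show "sobolev_dist \<sigma> (u t) (u 0) < \<eta>"
      using \<tau>[of t] \<open>\<eta> > 0\<close> by (cases "t = 0") (auto simp: sobolev_dist_self)
  qed
qed

lemma fourier_coeff_duhamel_start:
  assumes "duhamel_solution \<xi> lam u0 u"
  shows "fourier_coeff (u 0) k = fourier_coeff u0 k"
proof -
  have "(LINT \<rho>:{0..0}|lebesgue. X \<rho>) = 0" for X :: "real \<Rightarrow> complex"
    unfolding set_lebesgue_integral_def
    by (rule integral_eq_zero_AE, rule eventually_mono[OF AE_completion[OF AE_lborel_singleton[of "0::real"]]]) simp
  then show ?thesis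
    using assms by (simp add: duhamel_solution_def schroedinger_group_def)
qed

lemma decay_power_two_le:
  assumes "\<sigma> \<ge> 0"
  shows "decay \<sigma> (2 ^ J) \<le> (2 powr - \<sigma>) ^ J"
proof -
  have "decay \<sigma> (2 ^ J) \<le> ((2 ^ J)\<^sup>2) powr (- \<sigma> / 2)"
    unfolding decay_def using assms by (intro powr_mono2') auto
  also have "\<dots> = (2 powr - \<sigma>) ^ J"
    by (simp add: powr_powr powr_realpow[symmetric] mult_ac flip: powr_numeral)
  finally show ?thesis .
qed

text \<open>
  Here \<open>M\<close> bounds the coefficients of \<open>u t\<close> relative to \<open>decay \<sigma>\<close> for small times and \<open>C\<close> bounds
  the non-resonant part of the forcing in the same way. The resonance forces a coefficient of order
  \<open>N powr (- \<alpha> - 2)\<close> at \<open>N = 2 ^ J\<close>, while \<open>H\<^sup>\<sigma>\<close> permits only \<open>N powr - \<sigma>\<close>; the quotient of the permitted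
  size by the forced one is \<open>r ^ J\<close>, which tends to \<open>0\<close> but would have to stay above a fixed multiple
  of \<open>\<epsilon>\<close>.
\<close>

lemma no_solution_in_C01_sobolev:
  assumes \<alpha>: "\<alpha> > 0" and \<sigma>: "\<sigma> > \<alpha> + 2" and \<epsilon>: "\<epsilon> > 0"
    and D: "duhamel_solution (lacunary \<alpha>) lam (\<lambda>_. of_real \<epsilon>) u"
    and C01: "u \<in> C01_sobolev \<sigma>"
  shows False
proof -
  let ?q = "2 powr - \<alpha>"
  define M where "M = 5 / 4 * \<epsilon>"
  define C where "C = 2 powr \<sigma> / (1 - ?q) * M + \<bar>lam\<bar> * ((convolution_const \<sigma>)\<^sup>2 * M ^ 3)"
  define r where "r = 2 powr (2 + \<alpha> - \<sigma>)"
  have M0: "M > 0"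
    using \<epsilon> by (simp add: M_def)
  have C0: "C \<ge> 0"
    using ratio(2)[OF \<alpha>] M0 by (simp add: C_def)
  have r: "0 < r" "r < 1"
    using \<sigma> powr_less_mono[of "2 + \<alpha> - \<sigma>" 0 2] by (simp_all add: r_def)
  have sob: "u t \<in> sobolev \<sigma>" if "0 \<le> t" "t \<le> 1" for t
    using C01 that by (simp add: C01_sobolev_def)
  have "\<epsilon> / 4 > 0"
    using \<epsilon> by simp
  from C01_sobolev_near_start[OF C01 this]
  obtain \<tau> where \<tau>: "\<tau> > 0" "\<And>t. 0 \<le> t \<Longrightarrow> t \<le> 1 \<Longrightarrow> t < \<tau> \<Longrightarrow> sobolev_dist \<sigma> (u t) (u 0) < \<epsilon> / 4"
    by blast
  have near: "norm (fourier_coeff (u t) k - (if k = 0 then of_real \<epsilon> else 0)) \<le> \<epsilon> / 4 * decay \<sigma> k"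
    if "0 \<le> t" "t \<le> 1" "t < \<tau>" for t k
  proof -
    have "norm (fourier_coeff (u t) k - fourier_coeff (u 0) k) \<le> sobolev_dist \<sigma> (u t) (u 0) * decay \<sigma> k"
      using that by (intro fourier_coeff_diff_le_sobolev_dist sob) auto
    also have "\<dots> \<le> \<epsilon> / 4 * decay \<sigma> k"
      using \<tau>(2)[OF that] decay_pos[of \<sigma> k] by (intro mult_right_mono) auto
    finally show ?thesis
      by (simp add: fourier_coeff_duhamel_start[OF D] fourier_coeff_const)
  qed
  have bound: "norm (fourier_coeff (u t) k) \<le> M * decay \<sigma> k" if "0 \<le> t" "t \<le> 1" "t < \<tau>" for t k
  proof (cases "k = 0")
    case True
    have "norm (fourier_coeff (u t) 0) \<le> \<epsilon> + \<epsilon> / 4"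
      using near[OF that, of 0] \<epsilon> norm_triangle_sub[of "fourier_coeff (u t) 0" "of_real \<epsilon>"] by (simp add: decay_def)
    then show ?thesis
      using True by (simp add: M_def decay_def)
  next
    case False
    have "\<epsilon> / 4 * decay \<sigma> k \<le> M * decay \<sigma> k"
      using \<epsilon> decay_pos[of \<sigma> k] by (intro mult_right_mono) (auto simp: M_def)
    then show ?thesis
      using near[OF that, of k] False by simp
  qed
  have key: "\<epsilon> / 8 \<le> (C + M) * r ^ J" if J: "1 / \<tau> < 4 ^ J" for J
  proof -
    define N :: int where "N = 2 ^ J"
    define t :: real where "t = 1 / (of_int N)\<^sup>2"
    have N2: "(of_int N)\<^sup>2 = (4::real) ^ J"
      by (simp add: N_def power_mult[symmetric] mult.commute[of _ 2] power_mult)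
    have t: "0 < t" "t \<le> 1" "t < \<tau>"
      using J \<tau>(1) by (simp_all add: t_def N2 divide_simps mult.commute one_le_power)
    let ?F = "\<lambda>\<rho>. fourier_coeff (forcing (lacunary \<alpha>) lam (u \<rho>)) N"
    let ?X = "\<lambda>\<rho>. cis (- (t - \<rho>) * (of_int N)\<^sup>2) * ?F \<rho>"
    let ?b = "?q ^ J / 2"
    have X: "set_integrable lebesgue {0..t} ?X"
      using D t unfolding duhamel_solution_def schroedinger_group_def by auto
    have N0: "N \<noteq> 0"
      by (simp add: N_def)
    have "fourier_coeff (u t) N = \<i> * (LINT \<rho>:{0..t}|lebesgue. ?X \<rho>)"
      using D t N0 unfolding duhamel_solution_def schroedinger_group_def by (auto simp: fourier_coeff_const)
    then have eq: "norm (LINT \<rho>:{0..t}|lebesgue. ?X \<rho>) = norm (fourier_coeff (u t) N)"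
      by (simp add: norm_mult)
    \<comment> \<open>The resonant term has a definite sign up to time \<open>t\<close>, so no oscillation in time can cancel it.\<close>
    have "t * (?b * (\<epsilon> / 4) - C * decay \<sigma> N) \<le> norm (LINT \<rho>:{0..t}|lebesgue. ?X \<rho>)"
    proof (rule Re_set_integral_ge[OF less_imp_le[OF t(1)] X])
      fix \<rho> assume "\<rho> \<in> {0..t}"
      then have \<rho>: "0 \<le> \<rho>" "\<rho> \<le> t" "\<rho> \<le> 1" "\<rho> < \<tau>"
        using t by auto
      let ?\<theta> = "- (t - \<rho>) * (of_int N)\<^sup>2"
      have "t * (of_int N)\<^sup>2 = 1"
        using N0 by (simp add: t_def)
      moreover have "(t - \<rho>) * (of_int N)\<^sup>2 \<le> t * (of_int N)\<^sup>2" "0 \<le> (t - \<rho>) * (of_int N)\<^sup>2"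
        using \<rho> by (auto intro!: mult_right_mono)
      ultimately have \<theta>: "\<bar>?\<theta>\<bar> \<le> 1"
        by (simp only: mult_minus_left abs_minus_cancel abs_of_nonneg)
      let ?e = "?F \<rho> - of_real ?b * fourier_coeff (u \<rho>) 0"
      have e: "norm ?e \<le> C * decay \<sigma> N"
        unfolding C_def N_def using \<alpha> \<sigma> \<rho> bound[OF \<rho>(1,3,4)]
        by (intro forcing_resonance sobolev_imp_integrable[OF sob]) auto
      have "?X \<rho> = of_real ?b * (cis ?\<theta> * fourier_coeff (u \<rho>) 0) + cis ?\<theta> * ?e"
        by (simp only: right_diff_distrib) (simp add: ac_simps)
      then have "Re (?X \<rho>) = ?b * Re (cis ?\<theta> * fourier_coeff (u \<rho>) 0) + Re (cis ?\<theta> * ?e)"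
        by simp
      moreover have "?b * (\<epsilon> / 4) \<le> ?b * Re (cis ?\<theta> * fourier_coeff (u \<rho>) 0)"
        using near[OF \<rho>(1,3,4), of 0] by (intro mult_left_mono Re_cis_mult_ge[OF \<theta>]) (auto simp: decay_def)
      moreover have "\<bar>Re (cis ?\<theta> * ?e)\<bar> \<le> C * decay \<sigma> N"
      proof (rule order_trans[OF abs_Re_le_cmod])
        show "norm (cis ?\<theta> * ?e) \<le> C * decay \<sigma> N"
          using e by (simp add: norm_mult)
      qed
      ultimately show "?b * (\<epsilon> / 4) - C * decay \<sigma> N \<le> Re (?X \<rho>)"
        by linarith
    qed
    also have "\<dots> \<le> M * decay \<sigma> N"
      unfolding eq using t by (intro bound) auto
    finally have "?b * (\<epsilon> / 4) - C * decay \<sigma> N \<le> 4 ^ J * (M * decay \<sigma> N)"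
      using t by (simp add: t_def N2 divide_simps mult_ac)
    moreover have "C * decay \<sigma> N \<le> 4 ^ J * (C * decay \<sigma> N)"
      using mult_right_mono[of 1 "4 ^ J" "C * decay \<sigma> N"] C0 decay_pos[of \<sigma> N] by (simp add: one_le_power)
    \<comment> \<open>The factor \<open>4 ^ J = N\<^sup>2\<close> comes from integrating only up to time \<open>1 / N\<^sup>2\<close>.\<close>
    ultimately have "?q ^ J * (\<epsilon> / 8) \<le> 4 ^ J * ((C + M) * decay \<sigma> N)"
      by (simp add: algebra_simps)
    also have "\<dots> \<le> 4 ^ J * ((C + M) * (2 powr - \<sigma>) ^ J)"
      unfolding N_def using C0 M0 \<sigma> \<alpha> by (intro mult_left_mono decay_power_two_le) auto
    also have "\<dots> = ?q ^ J * ((C + M) * r ^ J)"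
    proof -
      have "4 * 2 powr - \<sigma> = ?q * r"
        by (simp add: r_def powr_add[symmetric] powr_diff powr_minus divide_simps) (simp add: powr_add)
      then have "4 ^ J * (2 powr - \<sigma>) ^ J = ?q ^ J * r ^ J"
        by (simp only: power_mult_distrib[symmetric])
      then show ?thesis
        by (simp add: mult_ac)
    qed
    finally show ?thesis
      using ratio(1)[OF \<alpha>] by (simp only: mult_le_cancel_left_pos zero_less_power)
  qed
  have "(\<lambda>J. (C + M) * r ^ J) \<longlonglongrightarrow> (C + M) * 0"
    using r by (intro tendsto_intros) auto
  then have "eventually (\<lambda>J. (C + M) * r ^ J < \<epsilon> / 8) sequentially"
    using \<epsilon> by (intro order_tendstoD(2)) auto
  moreover have "eventually (\<lambda>J. 1 / \<tau> < (4::real) ^ J) sequentially"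
  proof -
    obtain n where "1 / \<tau> < (4::real) ^ n"
      using real_arch_pow[of 4 "1 / \<tau>"] by auto
    then have "1 / \<tau> < (4::real) ^ J" if "J \<ge> n" for J
      using power_increasing[OF that, of "4::real"] by linarith
    then show ?thesis
      by (auto simp: eventually_sequentially)
  qed
  ultimately have "eventually (\<lambda>J. False) sequentially"
    by eventually_elim (use key in fastforce)
  then show False
    by simp
qed

text \<open>
  The exponent \<open>\<alpha>\<close> is the midpoint of the admissible interval between \<open>s\<close> and \<open>s + \<gamma> - 2\<close>. Constants are
  smooth data of norm exactly \<open>\<epsilon>\<close>, and continuity of the solution map at such data would entail that
  a solution in \<open>C([0,1]; H\<^sup>\<sigma>)\<close>, \<open>\<sigma> = s + \<gamma>\<close>, exists for them.
\<close>

theorem theorem1p4: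
  fixes lam s \<gamma> :: real
  assumes "s \<ge> 0" and "\<gamma> > 2"
  shows "\<exists>\<xi> :: real \<Rightarrow> real. (\<lambda>x. complex_of_real (\<xi> x)) \<in> sobolev s \<and> ill_posed \<xi> lam (s + \<gamma>)"
proof -
  define \<alpha> where "\<alpha> = s + (\<gamma> - 2) / 2"
  have \<alpha>: "\<alpha> > 0" "s < \<alpha>" "s + \<gamma> > \<alpha> + 2"
    unfolding \<alpha>_def using assms by (simp_all add: add_nonneg_pos field_simps)
  have "ill_posed (lacunary \<alpha>) lam (s + \<gamma>)"
    unfolding ill_posed_def
  proof (intro allI impI)
    fix \<epsilon> :: real assume \<epsilon>: "\<epsilon> > 0"
    let ?u0 = "\<lambda>_::real. complex_of_real \<epsilon>"
    have "?u0 \<in> smooth_periodic"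
      unfolding smooth_periodic_def
      by (auto intro!: exI[of _ "\<lambda>n. if n = 0 then ?u0 else (\<lambda>_. 0)"])
    then have "?u0 \<in> smooth_ball (s + \<gamma>) \<epsilon>"
      using \<epsilon> by (simp add: smooth_ball_def sobolev_norm_const)
    moreover have "\<not> solution_map_continuous_at (lacunary \<alpha>) lam (s + \<gamma>) ?u0"
    proof
      assume "solution_map_continuous_at (lacunary \<alpha>) lam (s + \<gamma>) ?u0"
      then obtain \<Phi> r where "r > 0" and \<Phi>: "\<And>v0. v0 \<in> sobolev (s + \<gamma>) \<Longrightarrow> sobolev_dist (s + \<gamma>) v0 ?u0 < r \<Longrightarrow>
          duhamel_solution (lacunary \<alpha>) lam v0 (\<Phi> v0) \<and> \<Phi> v0 \<in> C01_sobolev (s + \<gamma>)"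
        unfolding solution_map_continuous_at_def by blast
      then have "duhamel_solution (lacunary \<alpha>) lam ?u0 (\<Phi> ?u0)" "\<Phi> ?u0 \<in> C01_sobolev (s + \<gamma>)"
        using \<Phi>[OF sobolev_const] by (simp_all add: sobolev_dist_self)
      then show False
        by (rule no_solution_in_C01_sobolev[OF \<alpha>(1,3) \<epsilon>])
    qed
    ultimately show "\<exists>u0\<in>smooth_ball (s + \<gamma>) \<epsilon>. \<not> solution_map_continuous_at (lacunary \<alpha>) lam (s + \<gamma>) u0"
      by blast
  qed
  with lacunary_in_sobolev[OF \<alpha>(1) assms(1) \<alpha>(2)] show ?thesis
    by blast
qed

end
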